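(* Let $n\geq 1$. The map $\Upsilon$ restricts to an algebra isomorphism $$\Upsilon:(K\mathcal{E}_n,\lhd)\longrightarrow(K\mathcal{E}_n,\unlhd).$$
   Context: Fix an arbitrary field $K$. For a preorder $\leq_a$, write $i\sim_a j$ if $i\leq_a j$ and $j\leq_a i$, and $i<_a j$ if $i\leq_a j$ and not $i\sim_a j$. A double quasi-poset is a triple $P=(V(P),\leq_1,\leq_2)$ with $V(P)$ a finite set and $\leq_1,\leq_2$ two preorders on $V(P)$. An isomorphism is a bijection preserving and reflecting both preorders. $\mathcal{H}_{\mathbf{dqp}}$ is the $K$-vector space with basis the set of isomorphism classes of double quasi-posets. For a bijection $f:V(P)\to V(Q)$, $P\times_f Q=(V(P),\leq_1^f,\leq_2)$, where $i\leq_1^f j$ iff $f(i)\leq_1 f(j)$ in $Q$, and $\leq_2$ is the second preorder of $P$. $I_<(P,Q)$ is the set of bijections $f:V(P)\to V(Q)$ such that $i<_1 j\Rightarrow f(i)<_2 f(j)$ for all $i,j$; $I(P,Q)$ is the set of $f\in I_<(P,Q)$ such that moreover $i\leq_1 j\Rightarrow f(i)\leq_2 f(j)$ for all $i,j$. The associative products $\lhd$ and $\unlhd$ on $\mathcal{H}_{\mathbf{dqp}}$ are the bilinear extensions of $P\lhd Q=\sum_{f\in I_<(P,Q)}P\times_f Q$ and $P\unlhd Q=\sum_{f\in I(P,Q)}P\times_f Q$. Blow ups: for $i\in V(P)$ let $P_i=\{j\in V(P): i\sim_1 j\}$. If $P_i\neq\{i\}$ and $\leq^i$ is a total preorder on $P_i$,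 the elementary blow up of $P$ along $\leq^i$ is $P'=(V(P),\leq_1',\leq_2)$, where for $j,k\in P_i$, $j\leq_1' k$ iff $j\leq^i k$, and for pairs $(j,k)$ not both in $P_i$, $j\leq_1' k$ iff $j\leq_1 k$. A blow up of $P$ is a double quasi-poset obtained from $P$ by a (possibly empty) finite sequence of elementary blow ups. $B(P)$ is the set of blow ups of $P$, regarded as structures on the fixed set $V(P)$ (isomorphic but distinct blow ups are not identified in $B(P)$). $\Upsilon:\mathcal{H}_{\mathbf{dqp}}\to\mathcal{H}_{\mathbf{dqp}}$ is the linear map with $\Upsilon(P)=\sum_{P'\in B(P)}P'$. A packed word of length $n$ is a word $w=w_1\dots w_n$ over the positive integers whose set of letters is $\{1,\dots,r\}$ for some $r$. $\mathcal{E}_n$ is the set of packed words of length $n$. To $w\in\mathcal{E}_n$ one associates the double quasi-poset $P_w$ with $V(P_w)=\{1,\dots,n\}$, $i\leq_1 j$ iff $w_i\leq w_j$, and $\leq_2$ the usual order on $\{1,\dots,n\}$. The map $w\mapsto P_w$ is injective, and $K\mathcal{E}_n$ is identified with the subspace of $\mathcal{H}_{\mathbf{dqp}}$ spanned by the $P_w$, $w\in\mathcal{E}_n$, which is stable under $\lhd$ and $\unlhd$. "Algebra" means associative algebra, not necessarily unital; an algebra isomorphism is a bijective multiplicative linear map. *)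

theory Defs
  imports Complex_Main "HOL-Library.FuncSet" "HOL-Library.Poly_Mapping"
begin

section \<open>Preorders and double quasi-posets\<close>

text \<open>\<^const>\<open>preorder_on\<close> requires the relation to be contained in \<open>V \<times> V\<close>, so
  that two preorders on \<open>V\<close> are equal as soon as they agree on \<open>V\<close>.\<close>

definition sim :: "'a rel \<Rightarrow> 'a \<Rightarrow> 'a \<Rightarrow> bool" where
  "sim r i j \<longleftrightarrow> (i, j) \<in> r \<and> (j, i) \<in> r"

definition strictly :: "'a rel \<Rightarrow> 'a \<Rightarrow> 'a \<Rightarrow> bool" where
  "strictly r i j \<longleftrightarrow> (i, j) \<in> r \<and> \<not> sim r i j"

definition total_preorder_on :: "'a set \<Rightarrow> 'a rel \<Rightarrow> bool" where
  "total_preorder_on A r \<longleftrightarrow> preorder_on A r \<and> total_on A r"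

text \<open>Vertices are natural numbers; every finite set is in bijection with a set of natural
  numbers, so no isomorphism class is lost.\<close>

record dqp_struct =
  verts :: "nat set"
  le1 :: "nat rel"
  le2 :: "nat rel"

definition dqp :: "dqp_struct \<Rightarrow> bool" where
  "dqp P \<longleftrightarrow> finite (verts P) \<and> preorder_on (verts P) (le1 P) \<and> preorder_on (verts P) (le2 P)"

definition dqp_isomorphism :: "dqp_struct \<Rightarrow> dqp_struct \<Rightarrow> (nat \<Rightarrow> nat) \<Rightarrow> bool" where
  "dqp_isomorphism P Q g \<longleftrightarrow> bij_betw g (verts P) (verts Q) \<and>
     (\<forall>i\<in>verts P. \<forall>j\<in>verts P. (i, j) \<in> le1 P \<longleftrightarrow> (g i, g j) \<in> le1 Q) \<and>
     (\<forall>i\<in>verts P. \<forall>j\<in>verts P. (i, j) \<in> le2 P \<longleftrightarrow> (g i, g j) \<in> le2 Q)"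

definition dqp_iso :: "dqp_struct \<Rightarrow> dqp_struct \<Rightarrow> bool" where
  "dqp_iso P Q \<longleftrightarrow> dqp P \<and> dqp Q \<and> (\<exists>g. dqp_isomorphism P Q g)"

lemma dqp_isomorphism_inv:
  assumes "dqp_isomorphism P Q g"
  shows "dqp_isomorphism Q P (inv_into (verts P) g)"
proof -
  let ?h = "inv_into (verts P) g"
  have b: "bij_betw g (verts P) (verts Q)" using assms by (simp add: dqp_isomorphism_def)
  have hb: "bij_betw ?h (verts Q) (verts P)" using b by (rule bij_betw_inv_into)
  have "\<And>x. x \<in> verts Q \<Longrightarrow> ?h x \<in> verts P \<and> g (?h x) = x"
    using b hb by (auto simp: bij_betw_inv_into_right bij_betwE)
  then show ?thesis using assms hb unfolding dqp_isomorphism_def by metis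
qed

lemma dqp_isomorphism_comp:
  assumes "dqp_isomorphism P Q g" "dqp_isomorphism Q R h"
  shows "dqp_isomorphism P R (h \<circ> g)"
  using assms unfolding dqp_isomorphism_def
  by (auto intro: bij_betw_trans dest: bij_betwE)

lemma dqp_iso_refl: "dqp P \<Longrightarrow> dqp_iso P P"
  unfolding dqp_iso_def dqp_isomorphism_def by (auto intro!: exI[of _ id])

lemma dqp_iso_sym: "dqp_iso P Q \<Longrightarrow> dqp_iso Q P"
  unfolding dqp_iso_def using dqp_isomorphism_inv by blast

lemma dqp_iso_trans: "dqp_iso P Q \<Longrightarrow> dqp_iso Q R \<Longrightarrow> dqp_iso P R"
  unfolding dqp_iso_def using dqp_isomorphism_comp by blast

quotient_type dqp_class = dqp_struct / partial: dqp_iso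
  morphisms rep_class iso_class
proof (rule part_equivpI)
  have "dqp \<lparr>verts = {}, le1 = {}, le2 = {}\<rparr>" by (simp add: dqp_def)
  then show "\<exists>P. dqp_iso P P" using dqp_iso_refl by blast
  show "symp dqp_iso" by (auto intro: sympI dqp_iso_sym)
  show "transp dqp_iso" by (auto intro: transpI dqp_iso_trans)
qed

lemma iso_class_eq: "dqp_iso P Q \<Longrightarrow> iso_class P = iso_class Q"
  using Quotient3_dqp_class Quotient3_rel_abs by fastforce


section \<open>The space with basis the isomorphism classes\<close>

type_synonym 'k hdqp = "dqp_class \<Rightarrow>\<^sub>0 'k"

definition hscale :: "'k::field \<Rightarrow> ('b \<Rightarrow>\<^sub>0 'k) \<Rightarrow> ('b \<Rightarrow>\<^sub>0 'k)" where
  "hscale c x = Poly_Mapping.map ((*) c) x"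

lemma lookup_hscale [simp]: "Poly_Mapping.lookup (hscale c x) b = c * Poly_Mapping.lookup x b"
  by (simp add: hscale_def map.rep_eq when_def)

interpretation hvs: vector_space "hscale :: 'k::field \<Rightarrow> ('b \<Rightarrow>\<^sub>0 'k) \<Rightarrow> _"
  by unfold_locales (auto intro!: poly_mapping_eqI simp: lookup_add algebra_simps)

definition basis_vec :: "'b \<Rightarrow> 'b \<Rightarrow>\<^sub>0 'k::field" where
  "basis_vec b = Poly_Mapping.single b 1"

definition linear_ext :: "('b \<Rightarrow> 'c \<Rightarrow>\<^sub>0 'k::field) \<Rightarrow> ('b \<Rightarrow>\<^sub>0 'k) \<Rightarrow> ('c \<Rightarrow>\<^sub>0 'k)" where
  "linear_ext f x = (\<Sum>b\<in>Poly_Mapping.keys x. hscale (Poly_Mapping.lookup x b) (f b))"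

definition bilinear_ext ::
  "('b \<Rightarrow> 'b \<Rightarrow> 'b \<Rightarrow>\<^sub>0 'k::field) \<Rightarrow> ('b \<Rightarrow>\<^sub>0 'k) \<Rightarrow> ('b \<Rightarrow>\<^sub>0 'k) \<Rightarrow> ('b \<Rightarrow>\<^sub>0 'k)" where
  "bilinear_ext m x y =
     (\<Sum>b\<in>Poly_Mapping.keys x. \<Sum>c\<in>Poly_Mapping.keys y. hscale (Poly_Mapping.lookup x b * Poly_Mapping.lookup y c) (m b c))"


lemma linear_ext_basis: "linear_ext f (basis_vec b) = f b"
  by (simp add: linear_ext_def basis_vec_def)

lemma bilinear_ext_basis: "bilinear_ext m (basis_vec b) (basis_vec c) = m b c"
  by (simp add: bilinear_ext_def basis_vec_def)


section \<open>The two products\<close>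

definition twist :: "dqp_struct \<Rightarrow> (nat \<Rightarrow> nat) \<Rightarrow> dqp_struct \<Rightarrow> dqp_struct" where
  "twist P f Q = \<lparr>verts = verts P,
     le1 = {(i, j). i \<in> verts P \<and> j \<in> verts P \<and> (f i, f j) \<in> le1 Q},
     le2 = le2 P\<rparr>"

text \<open>Requiring the maps to be \<^const>\<open>extensional\<close> makes each bijection
  \<open>V(P) \<rightarrow> V(Q)\<close> be represented by exactly one function on \<^typ>\<open>nat\<close>, so that it is
  counted once in the sums below.\<close>

definition I_lt :: "dqp_struct \<Rightarrow> dqp_struct \<Rightarrow> (nat \<Rightarrow> nat) set" where
  "I_lt P Q = {f \<in> extensional (verts P). bij_betw f (verts P) (verts Q) \<and>
     (\<forall>i\<in>verts P. \<forall>j\<in>verts P. strictly (le1 P) i j \<longrightarrow> strictly (le2 Q) (f i) (f j))}"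

definition I_le :: "dqp_struct \<Rightarrow> dqp_struct \<Rightarrow> (nat \<Rightarrow> nat) set" where
  "I_le P Q = {f \<in> I_lt P Q.
     \<forall>i\<in>verts P. \<forall>j\<in>verts P. (i, j) \<in> le1 P \<longrightarrow> (f i, f j) \<in> le2 Q}"

definition transport ::
  "dqp_struct \<Rightarrow> dqp_struct \<Rightarrow> (nat \<Rightarrow> nat) \<Rightarrow> (nat \<Rightarrow> nat) \<Rightarrow> (nat \<Rightarrow> nat) \<Rightarrow> (nat \<Rightarrow> nat)" where
  "transport P P' g h f = restrict (\<lambda>x. h (f (inv_into (verts P) g x))) (verts P')"

lemma transport_I:
  assumes g: "dqp_isomorphism P P' g" and h: "dqp_isomorphism Q Q' h"
  shows "f \<in> I_lt P Q \<Longrightarrow> transport P P' g h f \<in> I_lt P' Q'"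
    and "f \<in> I_le P Q \<Longrightarrow> transport P P' g h f \<in> I_le P' Q'"
proof -
  let ?k = "inv_into (verts P) g"
  let ?t = "transport P P' g h f"
  have k: "dqp_isomorphism P' P ?k" using g by (rule dqp_isomorphism_inv)
  then have kv: "\<And>x. x \<in> verts P' \<Longrightarrow> ?k x \<in> verts P"
    by (auto simp: dqp_isomorphism_def dest: bij_betwE)
  have lt: "?t \<in> I_lt P' Q'" if f: "f \<in> I_lt P Q"
  proof -
    have fb: "bij_betw f (verts P) (verts Q)" using f by (simp add: I_lt_def)
    then have fv: "\<And>x. x \<in> verts P \<Longrightarrow> f x \<in> verts Q" by (auto dest: bij_betwE)
    have "bij_betw (h \<circ> (f \<circ> ?k)) (verts P') (verts Q')"
      using k h fb unfolding dqp_isomorphism_def by (blast intro: bij_betw_trans)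
    then have "bij_betw ?t (verts P') (verts Q')"
      by (rule bij_betw_cong[THEN iffD1, rotated]) (simp add: transport_def)
    moreover have "strictly (le2 Q') (?t i) (?t j)"
      if ij: "i \<in> verts P'" "j \<in> verts P'" and s: "strictly (le1 P') i j" for i j
    proof -
      have "strictly (le1 P) (?k i) (?k j)"
        using s k ij by (simp add: strictly_def sim_def dqp_isomorphism_def)
      then have "strictly (le2 Q) (f (?k i)) (f (?k j))"
        using f kv ij by (simp add: I_lt_def)
      then show ?thesis
        using h kv fv ij by (simp add: strictly_def sim_def dqp_isomorphism_def transport_def)
    qed
    ultimately show ?thesis by (simp add: I_lt_def transport_def)
  qed
  show "f \<in> I_lt P Q \<Longrightarrow> ?t \<in> I_lt P' Q'" by (rule lt)
  assume f: "f \<in> I_le P Q"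
  then have f': "f \<in> I_lt P Q" by (simp add: I_le_def)
  then have fv: "\<And>x. x \<in> verts P \<Longrightarrow> f x \<in> verts Q" by (auto simp: I_lt_def dest: bij_betwE)
  have "(?t i, ?t j) \<in> le2 Q'"
    if ij: "i \<in> verts P'" "j \<in> verts P'" and s: "(i, j) \<in> le1 P'" for i j
  proof -
    have "(?k i, ?k j) \<in> le1 P" using s k ij by (simp add: dqp_isomorphism_def)
    then have "(f (?k i), f (?k j)) \<in> le2 Q" using f kv ij by (simp add: I_le_def)
    then show ?thesis using h kv fv ij by (simp add: dqp_isomorphism_def transport_def)
  qed
  with lt[OF f'] show "?t \<in> I_le P' Q'" by (simp add: I_le_def)
qed

lemma transport_inverse:
  assumes g: "dqp_isomorphism P P' g" and h: "dqp_isomorphism Q Q' h" and f: "f \<in> I_lt P Q"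
  shows "transport P' P (inv_into (verts P) g) (inv_into (verts Q) h) (transport P P' g h f) = f"
proof (rule extensionalityI[where A = "verts P"])
  show "f \<in> extensional (verts P)" using f by (simp add: I_lt_def)
  let ?k = "inv_into (verts P) g"
  fix x assume x: "x \<in> verts P"
  have gb: "bij_betw g (verts P) (verts P')" and hb: "bij_betw h (verts Q) (verts Q')"
    using g h by (simp_all add: dqp_isomorphism_def)
  have "inv_into (verts P') ?k x = g x"
    by (rule inv_into_f_eq)
      (use gb x in \<open>auto simp: bij_betw_inv_into_left dest: bij_betwE
          intro: bij_betw_imp_inj_on[OF bij_betw_inv_into]\<close>)
  moreover have "g x \<in> verts P'" using gb x by (auto dest: bij_betwE)
  moreover have "?k (g x) = x" using gb x by (simp add: bij_betw_inv_into_left)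
  moreover have "inv_into (verts Q) h (h (f x)) = f x"
    using f hb x by (auto simp: I_lt_def bij_betw_inv_into_left dest: bij_betwE)
  ultimately show "transport P' P ?k (inv_into (verts Q) h) (transport P P' g h f) x = f x"
    using x by (simp add: transport_def)
qed (simp add: transport_def)

lemma dqp_twist:
  assumes "dqp P" "dqp Q" "bij_betw f (verts P) (verts Q)"
  shows "dqp (twist P f Q)"
proof -
  have "f x \<in> verts Q" if "x \<in> verts P" for x using assms that by (auto dest: bij_betwE)
  then have "preorder_on (verts P) {(i, j). i \<in> verts P \<and> j \<in> verts P \<and> (f i, f j) \<in> le1 Q}"
    using assms(2) unfolding dqp_def preorder_on_def
    by (auto simp: refl_on_def intro!: transI dest: transD)
  then show ?thesis using assms(1) by (simp add: dqp_def twist_def)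
qed

lemma twist_transport:
  assumes d: "dqp P" "dqp P'" "dqp Q" "dqp Q'"
    and g: "dqp_isomorphism P P' g" and h: "dqp_isomorphism Q Q' h" and f: "f \<in> I_lt P Q"
  shows "dqp_iso (twist P f Q) (twist P' (transport P P' g h f) Q')"
proof -
  have "bij_betw f (verts P) (verts Q)"
    "bij_betw (transport P P' g h f) (verts P') (verts Q')"
    using f transport_I(1)[OF g h f] by (simp_all add: I_lt_def)
  moreover have "dqp_isomorphism (twist P f Q) (twist P' (transport P P' g h f) Q') g"
  proof -
    have gb: "bij_betw g (verts P) (verts P')" using g by (simp add: dqp_isomorphism_def)
    have "transport P P' g h f (g x) = h (f x)" if "x \<in> verts P" for x
      using that gb bij_betw_inv_into_left[OF gb that]
      by (auto simp: transport_def dest: bij_betwE)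
    moreover have "f x \<in> verts Q" "g x \<in> verts P'" if "x \<in> verts P" for x
      using f gb that by (auto simp: I_lt_def dest: bij_betwE)
    ultimately show ?thesis
      using g h by (simp add: dqp_isomorphism_def twist_def)
  qed
  ultimately show ?thesis using d dqp_twist unfolding dqp_iso_def by blast
qed

lemma sum_twist_cong:
  assumes P: "dqp_iso P P'" and Q: "dqp_iso Q Q'"
    and S: "S = I_lt \<or> S = I_le"
  shows "(\<Sum>f\<in>S P Q. basis_vec (iso_class (twist P f Q))) =
         (\<Sum>f\<in>S P' Q'. basis_vec (iso_class (twist P' f Q')))"
proof -
  obtain g h where g: "dqp_isomorphism P P' g" and h: "dqp_isomorphism Q Q' h"
    using P Q unfolding dqp_iso_def by blast
  let ?g = "inv_into (verts P) g" and ?h = "inv_into (verts Q) h"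
  have g': "dqp_isomorphism P' P ?g" and h': "dqp_isomorphism Q' Q ?h"
    using g h by (auto intro: dqp_isomorphism_inv)
  have sub: "S A B \<subseteq> I_lt A B" for A B using S by (auto simp: I_le_def)
  have gb: "bij_betw g (verts P) (verts P')" and hb: "bij_betw h (verts Q) (verts Q')"
    using g h by (simp_all add: dqp_isomorphism_def)
  show ?thesis
  proof (rule sum.reindex_bij_witness[where i = "transport P' P ?g ?h" and j = "transport P P' g h"])
    fix f assume f: "f \<in> S P Q"
    then have f': "f \<in> I_lt P Q" using sub by blast
    show "transport P' P ?g ?h (transport P P' g h f) = f"
      by (rule transport_inverse[OF g h f'])
    show "transport P P' g h f \<in> S P' Q'" using f S transport_I[OF g h] by auto
    show "basis_vec (iso_class (twist P' (transport P P' g h f) Q')) =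
          basis_vec (iso_class (twist P f Q))"
      using twist_transport[OF _ _ _ _ g h f'] P Q iso_class_eq
      unfolding dqp_iso_def by metis
  next
    fix f assume f: "f \<in> S P' Q'"
    then have f': "f \<in> I_lt P' Q'" using sub by blast
    show t: "transport P' P ?g ?h f \<in> S P Q" using f S transport_I[OF g' h'] by auto
    have t': "transport P P' g h (transport P' P ?g ?h f) \<in> I_lt P' Q'"
      using t sub transport_I(1)[OF g h] by blast
    show "transport P P' g h (transport P' P ?g ?h f) = f"
    proof (rule extensionalityI[where A = "verts P'"])
      show "f \<in> extensional (verts P')" using f' by (simp add: I_lt_def)
      fix x assume x: "x \<in> verts P'"
      have 1: "?g x \<in> verts P" using g' x by (auto simp: dqp_isomorphism_def dest: bij_betwE)
      have 2: "inv_into (verts P') ?g (?g x) = x"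
        by (rule bij_betw_inv_into_left[OF _ x, of _ "verts P"])
          (use g' in \<open>simp add: dqp_isomorphism_def\<close>)
      have "f x \<in> verts Q'" using f' x by (auto simp: I_lt_def dest: bij_betwE)
      then have "h (?h (f x)) = f x" using hb by (simp add: bij_betw_inv_into_right)
      with 1 2 x show "transport P P' g h (transport P' P ?g ?h f) x = f x"
        by (simp add: transport_def)
    qed (simp add: transport_def)
  qed
qed

lift_definition lhd_class :: "dqp_class \<Rightarrow> dqp_class \<Rightarrow> dqp_class \<Rightarrow>\<^sub>0 'k::field"
  is "\<lambda>P Q. \<Sum>f\<in>I_lt P Q. basis_vec (iso_class (twist P f Q))"
  by (rule sum_twist_cong) auto

lift_definition unlhd_class :: "dqp_class \<Rightarrow> dqp_class \<Rightarrow> dqp_class \<Rightarrow>\<^sub>0 'k::field"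
  is "\<lambda>P Q. \<Sum>f\<in>I_le P Q. basis_vec (iso_class (twist P f Q))"
  by (rule sum_twist_cong) auto

definition prod_lhd :: "'k::field hdqp \<Rightarrow> 'k hdqp \<Rightarrow> 'k hdqp" where
  "prod_lhd = bilinear_ext lhd_class"

definition prod_unlhd :: "'k::field hdqp \<Rightarrow> 'k hdqp \<Rightarrow> 'k hdqp" where
  "prod_unlhd = bilinear_ext unlhd_class"


lemma finite_I_lt:
  assumes "dqp P" "dqp Q"
  shows "finite (I_lt P Q)"
proof (rule finite_subset)
  show "I_lt P Q \<subseteq> verts P \<rightarrow>\<^sub>E verts Q" by (auto simp: I_lt_def PiE_def dest: bij_betwE)
  show "finite (verts P \<rightarrow>\<^sub>E verts Q)" using assms by (intro finite_PiE) (simp_all add: dqp_def)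
qed

lemma prod_lhd_basis:
  assumes "dqp P" "dqp Q"
  shows "prod_lhd (basis_vec (iso_class P)) (basis_vec (iso_class Q)) =
    (\<Sum>f\<in>I_lt P Q. basis_vec (iso_class (twist P f Q)))"
  using lhd_class.abs_eq[of P Q] dqp_iso_refl[OF assms(1)] dqp_iso_refl[OF assms(2)]
  by (simp add: prod_lhd_def bilinear_ext_basis eq_onp_def)

lemma prod_unlhd_basis:
  assumes "dqp P" "dqp Q"
  shows "prod_unlhd (basis_vec (iso_class P)) (basis_vec (iso_class Q)) =
    (\<Sum>f\<in>I_le P Q. basis_vec (iso_class (twist P f Q)))"
  using unlhd_class.abs_eq[of P Q] dqp_iso_refl[OF assms(1)] dqp_iso_refl[OF assms(2)]
  by (simp add: prod_unlhd_def bilinear_ext_basis eq_onp_def)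


section \<open>Blow ups\<close>

definition sim_class :: "dqp_struct \<Rightarrow> nat \<Rightarrow> nat set" where
  "sim_class P i = {j \<in> verts P. sim (le1 P) i j}"

definition blow_up_along :: "dqp_struct \<Rightarrow> nat \<Rightarrow> nat rel \<Rightarrow> dqp_struct" where
  "blow_up_along P i r =
     P\<lparr>le1 := {(j, k). if j \<in> sim_class P i \<and> k \<in> sim_class P i then (j, k) \<in> r
                        else (j, k) \<in> le1 P}\<rparr>"

inductive elementary_blow_up :: "dqp_struct \<Rightarrow> dqp_struct \<Rightarrow> bool" where
  "\<lbrakk>i \<in> verts P; sim_class P i \<noteq> {i}; total_preorder_on (sim_class P i) r\<rbrakk>
     \<Longrightarrow> elementary_blow_up P (blow_up_along P i r)"

text \<open>A set of structures on the fixed vertex set, not of isomorphism classes.\<close>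

definition blow_ups :: "dqp_struct \<Rightarrow> dqp_struct set" where
  "blow_ups P = {P'. elementary_blow_up\<^sup>*\<^sup>* P P'}"

definition relabel :: "(nat \<Rightarrow> nat) \<Rightarrow> dqp_struct \<Rightarrow> dqp_struct" where
  "relabel g P = \<lparr>verts = g ` verts P, le1 = map_prod g g ` le1 P, le2 = map_prod g g ` le2 P\<rparr>"

lemma elementary_blow_up_verts:
  "elementary_blow_up P P' \<Longrightarrow> verts P' = verts P \<and> le2 P' = le2 P"
  by (auto elim!: elementary_blow_up.cases simp: blow_up_along_def)

lemma preorder_onD:
  assumes "preorder_on A r"
  shows "r \<subseteq> A \<times> A" "\<And>x. x \<in> A \<Longrightarrow> (x, x) \<in> r"
    "\<And>x y z. (x, y) \<in> r \<Longrightarrow> (y, z) \<in> r \<Longrightarrow> (x, z) \<in> r"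
  using assms unfolding preorder_on_def refl_on_def by (blast dest: transD)+

lemma elementary_blow_up_dqp:
  assumes e: "elementary_blow_up P P'" and d: "dqp P"
  shows "dqp P'"
proof -
  obtain i r where P': "P' = blow_up_along P i r" and i: "i \<in> verts P"
    and r: "preorder_on (sim_class P i) r"
    using e by cases (auto simp: total_preorder_on_def)
  let ?C = "sim_class P i"
  note p = preorder_onD[of "verts P" "le1 P"]
  have p1: "preorder_on (verts P) (le1 P)" using d by (simp add: dqp_def)
  have mid: "y \<in> ?C" if "x \<in> ?C" "z \<in> ?C" "(x, y) \<in> le1 P" "(y, z) \<in> le1 P" for x y z
    using that p(1,3)[OF p1] unfolding sim_class_def sim_def by blast
  have le: "(x, y) \<in> le1 P" if "(x, y) \<in> le1 P'" for x y
  proof (cases "x \<in> ?C \<and> y \<in> ?C")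
    case True
    then have "(x, i) \<in> le1 P" "(i, y) \<in> le1 P" by (simp_all add: sim_class_def sim_def)
    then show ?thesis by (rule p(3)[OF p1])
  qed (use that in \<open>simp add: P' blow_up_along_def\<close>)
  have "preorder_on (verts P) (le1 P')"
    unfolding preorder_on_def
  proof (intro conjI)
    show "le1 P' \<subseteq> verts P \<times> verts P" using le p(1)[OF p1] by auto
    show "refl_on (verts P) (le1 P')"
      using p(2)[OF p1] preorder_onD(2)[OF r]
      by (auto simp: refl_on_def P' blow_up_along_def)
    show "trans (le1 P')"
    proof (rule transI)
      fix x y z assume xy: "(x, y) \<in> le1 P'" and yz: "(y, z) \<in> le1 P'"
      have xz: "(x, z) \<in> le1 P" using le[OF xy] le[OF yz] p(3)[OF p1] by blast
      show "(x, z) \<in> le1 P'"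
      proof (cases "x \<in> ?C \<and> z \<in> ?C")
        case True
        then have "y \<in> ?C" using mid le[OF xy] le[OF yz] by blast
        with True xy yz have "(x, z) \<in> r"
          using preorder_onD(3)[OF r] by (auto simp: P' blow_up_along_def)
        with True show ?thesis by (simp add: P' blow_up_along_def)
      qed (use xz in \<open>auto simp: P' blow_up_along_def\<close>)
    qed
  qed
  then show ?thesis using d elementary_blow_up_verts[OF e] by (simp add: dqp_def)
qed

lemma blow_ups_dqp:
  assumes "P' \<in> blow_ups P" "dqp P"
  shows "dqp P' \<and> verts P' = verts P \<and> le2 P' = le2 P"
proof -
  have "elementary_blow_up\<^sup>*\<^sup>* P P'" using assms by (simp add: blow_ups_def)
  then show ?thesis using assms(2)
    by (induction rule: rtranclp_induct) (auto dest: elementary_blow_up_verts elementary_blow_up_dqp)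
qed

lemma relabel_mem:
  assumes "inj_on g V" "r \<subseteq> V \<times> V" "x \<in> V" "y \<in> V"
  shows "(g x, g y) \<in> map_prod g g ` r \<longleftrightarrow> (x, y) \<in> r"
proof
  assume "(g x, g y) \<in> map_prod g g ` r"
  then obtain a b where ab: "(a, b) \<in> r" "g x = g a" "g y = g b" by auto
  then have "a \<in> V" "b \<in> V" using assms(2) by auto
  then have "x = a" "y = b" using ab assms by (auto dest: inj_onD)
  then show "(x, y) \<in> r" using ab by simp
qed force

lemma rel_eq_on_image:
  assumes "L \<subseteq> g ` V \<times> g ` V" "R \<subseteq> g ` V \<times> g ` V"
    and "\<And>x y. x \<in> V \<Longrightarrow> y \<in> V \<Longrightarrow> (g x, g y) \<in> L \<longleftrightarrow> (g x, g y) \<in> R"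
  shows "L = R"
proof (rule set_eqI)
  fix p
  show "p \<in> L \<longleftrightarrow> p \<in> R"
  proof (cases "p \<in> g ` V \<times> g ` V")
    case True
    then obtain x y where "x \<in> V" "y \<in> V" "p = (g x, g y)" by blast
    with assms(3) show ?thesis by simp
  next
    case False
    with assms(1,2) show ?thesis by blast
  qed
qed

lemma dqp_subset: "dqp P \<Longrightarrow> le1 P \<subseteq> verts P \<times> verts P \<and> le2 P \<subseteq> verts P \<times> verts P"
  by (simp add: dqp_def preorder_onD(1))

lemma preorder_on_relabel:
  assumes g: "inj_on g A" and r: "preorder_on A r"
  shows "preorder_on (g ` A) (map_prod g g ` r)"
  unfolding preorder_on_def
proof (intro conjI)
  note p = preorder_onD[OF r]
  show "map_prod g g ` r \<subseteq> g ` A \<times> g ` A" using p(1) by auto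
  show "refl_on (g ` A) (map_prod g g ` r)" using p(2) by (force simp: refl_on_def)
  show "trans (map_prod g g ` r)"
  proof (rule transI)
    fix x y z assume "(x, y) \<in> map_prod g g ` r" "(y, z) \<in> map_prod g g ` r"
    then obtain a b b' c where *: "(a, b) \<in> r" "(b', c) \<in> r" "x = g a" "y = g b" "y = g b'" "z = g c"
      by auto
    then have "b = b'" using p(1) g by (auto dest: inj_onD)
    with * p(3) have "(a, c) \<in> r" by blast
    with * show "(x, z) \<in> map_prod g g ` r" by force
  qed
qed

lemma dqp_relabel: "dqp P \<Longrightarrow> inj_on g (verts P) \<Longrightarrow> dqp (relabel g P)"
  by (simp add: dqp_def relabel_def preorder_on_relabel)

lemma dqp_iso_relabel:
  assumes d: "dqp P" and g: "inj_on g (verts P)"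
  shows "dqp_iso P (relabel g P)"
proof -
  have "dqp_isomorphism P (relabel g P) g"
    unfolding dqp_isomorphism_def
    using g dqp_subset[OF d] by (auto simp: relabel_def bij_betw_def relabel_mem)
  then show ?thesis using d dqp_relabel[OF d g] unfolding dqp_iso_def by blast
qed

lemma relabel_inv:
  assumes d: "dqp P" and k: "\<And>x. x \<in> verts P \<Longrightarrow> k (g x) = x"
  shows "relabel k (relabel g P) = P"
proof -
  have "map_prod k k ` map_prod g g ` r = r" if "r \<subseteq> verts P \<times> verts P" for r
  proof -
    have "map_prod k k (map_prod g g p) = p" if "p \<in> r" for p
      using that \<open>r \<subseteq> _\<close> k by (cases p) auto
    then show ?thesis by (simp add: image_image)
  qed
  moreover have "k ` g ` verts P = verts P" using k by (simp add: image_image)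
  ultimately show ?thesis using dqp_subset[OF d] by (simp add: relabel_def)
qed

lemma relabel_isomorphism:
  assumes "dqp P" "dqp P'" "dqp_isomorphism P P' g"
  shows "P' = relabel g P"
proof -
  have gb: "g ` verts P = verts P'" using assms(3) by (simp add: dqp_isomorphism_def bij_betw_def)
  have eq: "s = map_prod g g ` r"
    if rs: "r \<subseteq> verts P \<times> verts P" "s \<subseteq> verts P' \<times> verts P'"
      "\<forall>i\<in>verts P. \<forall>j\<in>verts P. (i, j) \<in> r \<longleftrightarrow> (g i, g j) \<in> s" for r s
  proof
    show "map_prod g g ` r \<subseteq> s" using rs by auto
    show "s \<subseteq> map_prod g g ` r"
    proof
      fix p assume p: "p \<in> s"
      then obtain i j where "i \<in> verts P" "j \<in> verts P" "p = (g i, g j)"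
        using rs(2) gb by (cases p) blast
      with p rs(3) show "p \<in> map_prod g g ` r" by force
    qed
  qed
  have "le1 P' = map_prod g g ` le1 P" "le2 P' = map_prod g g ` le2 P"
    by (rule eq; use assms dqp_subset in \<open>simp add: dqp_isomorphism_def\<close>)+
  then show ?thesis using gb by (simp add: relabel_def)
qed

lemma elementary_blow_up_relabel:
  assumes e: "elementary_blow_up P P'" and d: "dqp P" and g: "inj_on g (verts P)"
  shows "elementary_blow_up (relabel g P) (relabel g P')"
proof -
  obtain i r where P': "P' = blow_up_along P i r" and i: "i \<in> verts P"
    and ne: "sim_class P i \<noteq> {i}" and r: "total_preorder_on (sim_class P i) r"
    using e by cases auto
  let ?C = "sim_class P i" and ?r = "map_prod g g ` r"
  have CV: "?C \<subseteq> verts P" by (auto simp: sim_class_def)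
  have gC: "inj_on g ?C" using g CV by (rule inj_on_subset)
  have C: "sim_class (relabel g P) (g i) = g ` ?C"
  proof -
    have "sim (map_prod g g ` le1 P) (g i) (g x) \<longleftrightarrow> sim (le1 P) i x" if "x \<in> verts P" for x
      using relabel_mem[OF g conjunct1[OF dqp_subset[OF d]] i that]
        relabel_mem[OF g conjunct1[OF dqp_subset[OF d]] that i] by (simp add: sim_def)
    then show ?thesis by (auto simp: sim_class_def relabel_def)
  qed
  have rp: "preorder_on ?C r" and rt: "total_on ?C r" using r by (simp_all add: total_preorder_on_def)
  have "total_on (g ` ?C) ?r" using rt by (force simp: total_on_def)
  then have tot: "total_preorder_on (g ` ?C) ?r"
    using preorder_on_relabel[OF gC rp] by (simp add: total_preorder_on_def)
  have gne: "g ` ?C \<noteq> {g i}"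
  proof
    assume "g ` ?C = {g i}"
    moreover have "i \<in> ?C" using i d by (auto simp: sim_class_def sim_def dqp_def dest: preorder_onD(2))
    ultimately have "?C = {i}" using gC by (auto dest: inj_onD)
    with ne show False by simp
  qed
  have "g i \<in> verts (relabel g P)" using i by (simp add: relabel_def)
  with gne tot have "elementary_blow_up (relabel g P) (blow_up_along (relabel g P) (g i) ?r)"
    by (intro elementary_blow_up.intros) (simp_all add: C)
  moreover have "relabel g P' = blow_up_along (relabel g P) (g i) ?r"
  proof -
    have d': "dqp P'" using elementary_blow_up_dqp[OF e d] .
    have v: "verts P' = verts P" using elementary_blow_up_verts[OF e] by simp
    have rC: "r \<subseteq> ?C \<times> ?C" using preorder_onD(1)[OF rp] .
    have mC: "g x \<in> g ` ?C \<longleftrightarrow> x \<in> ?C" if "x \<in> verts P" for x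
      using g CV that by (simp add: inj_on_image_mem_iff)
    have "map_prod g g ` le1 P' = {(j, k). if j \<in> g ` ?C \<and> k \<in> g ` ?C then (j, k) \<in> ?r
                        else (j, k) \<in> map_prod g g ` le1 P}" (is "?L = ?R")
    proof -
      have in1: "?L \<subseteq> g ` verts P \<times> g ` verts P" using dqp_subset[OF d'] v by auto
      have in2: "?R \<subseteq> g ` verts P \<times> g ` verts P"
        using dqp_subset[OF d] CV by (auto split: if_splits)
      have "(g x, g y) \<in> ?L \<longleftrightarrow> (g x, g y) \<in> ?R" if xy: "x \<in> verts P" "y \<in> verts P" for x y
      proof -
        have "(g x, g y) \<in> ?L \<longleftrightarrow> (x, y) \<in> le1 P'"
          using relabel_mem[OF g _ xy] dqp_subset[OF d'] v by auto
        moreover have "(g x, g y) \<in> map_prod g g ` le1 P \<longleftrightarrow> (x, y) \<in> le1 P"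
          using relabel_mem[OF g _ xy] dqp_subset[OF d] by auto
        moreover have "(g x, g y) \<in> ?r \<longleftrightarrow> (x, y) \<in> r"
          by (rule relabel_mem[OF g _ xy]) (use rC CV in auto)
        ultimately show ?thesis using mC xy by (simp add: P' blow_up_along_def)
      qed
      then show ?thesis using in1 in2 by (intro rel_eq_on_image[of _ g "verts P"])
    qed
    then show ?thesis
      using v elementary_blow_up_verts[OF e]
      by (simp add: relabel_def blow_up_along_def C[unfolded relabel_def])
  qed
  ultimately show ?thesis by simp
qed

lemma blow_ups_relabel:
  assumes P': "P' \<in> blow_ups P" and d: "dqp P" and g: "inj_on g (verts P)"
  shows "relabel g P' \<in> blow_ups (relabel g P)"
proof -
  have "elementary_blow_up\<^sup>*\<^sup>* P P'" using P' by (simp add: blow_ups_def)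
  then have "elementary_blow_up\<^sup>*\<^sup>* (relabel g P) (relabel g P')"
  proof (induction rule: rtranclp_induct)
    case (step y z)
    have "dqp y" "inj_on g (verts y)" using step.hyps(1) blow_ups_dqp[of y P] d g
      by (simp_all add: blow_ups_def)
    then have "elementary_blow_up (relabel g y) (relabel g z)"
      using step.hyps(2) by (intro elementary_blow_up_relabel)
    with step.IH show ?case by (rule rtranclp.rtrancl_into_rtrancl)
  qed simp
  then show ?thesis by (simp add: blow_ups_def)
qed

lemma sum_blow_ups_cong:
  assumes "dqp_iso P Q"
  shows "(\<Sum>P'\<in>blow_ups P. basis_vec (iso_class P')) = (\<Sum>P'\<in>blow_ups Q. basis_vec (iso_class P'))"
proof -
  obtain g where d: "dqp P" "dqp Q" and g: "dqp_isomorphism P Q g"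
    using assms unfolding dqp_iso_def by blast
  let ?k = "inv_into (verts P) g"
  have gb: "bij_betw g (verts P) (verts Q)" using g by (simp add: dqp_isomorphism_def)
  have kb: "bij_betw ?k (verts Q) (verts P)" using gb by (rule bij_betw_inv_into)
  have gi: "inj_on g (verts P)" and ki: "inj_on ?k (verts Q)"
    using gb kb by (simp_all add: bij_betw_def)
  have Q: "Q = relabel g P" using relabel_isomorphism[OF d g] .
  have P: "P = relabel ?k Q"
    using relabel_isomorphism[OF d(2) d(1) dqp_isomorphism_inv[OF g]] .
  show ?thesis
  proof (rule sum.reindex_bij_witness[where i = "relabel ?k" and j = "relabel g"])
    fix X assume X: "X \<in> blow_ups P"
    note b = blow_ups_dqp[OF X d(1)]
    show "relabel ?k (relabel g X) = X"
      using b gb by (intro relabel_inv) (auto simp: bij_betw_inv_into_left)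
    show "relabel g X \<in> blow_ups Q" using blow_ups_relabel[OF X d(1) gi] Q by simp
    have "dqp_iso X (relabel g X)" using b gi by (intro dqp_iso_relabel) auto
    then show "basis_vec (iso_class (relabel g X)) = basis_vec (iso_class X)"
      using iso_class_eq by metis
  next
    fix X assume X: "X \<in> blow_ups Q"
    note b = blow_ups_dqp[OF X d(2)]
    show "relabel g (relabel ?k X) = X"
      using b gb by (intro relabel_inv) (auto simp: bij_betw_inv_into_right)
    show "relabel ?k X \<in> blow_ups P" using blow_ups_relabel[OF X d(2) ki] P by simp
  qed
qed

lift_definition upsilon_class :: "dqp_class \<Rightarrow> dqp_class \<Rightarrow>\<^sub>0 'k::field"
  is "\<lambda>P. \<Sum>P'\<in>blow_ups P. basis_vec (iso_class P')"
  by (rule sum_blow_ups_cong)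

definition upsilon :: "'k::field hdqp \<Rightarrow> 'k hdqp" where
  "upsilon = linear_ext upsilon_class"


lemma upsilon_basis:
  assumes "dqp P"
  shows "upsilon (basis_vec (iso_class P)) = (\<Sum>P'\<in>blow_ups P. basis_vec (iso_class P'))"
  using upsilon_class.abs_eq[of P] dqp_iso_refl[OF assms]
  by (simp add: upsilon_def linear_ext_basis)

lemma finite_blow_ups:
  assumes "dqp P"
  shows "finite (blow_ups P)"
proof (rule finite_subset)
  let ?F = "\<lambda>r. \<lparr>verts = verts P, le1 = r, le2 = le2 P\<rparr>"
  show "blow_ups P \<subseteq> ?F ` Pow (verts P \<times> verts P)"
  proof
    fix X assume X: "X \<in> blow_ups P"
    note b = blow_ups_dqp[OF X assms]
    then have "X = ?F (le1 X)" by simp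
    moreover have "le1 X \<subseteq> verts P \<times> verts P" using b dqp_subset[of X] by simp
    ultimately show "X \<in> ?F ` Pow (verts P \<times> verts P)" by blast
  qed
  show "finite (?F ` Pow (verts P \<times> verts P))" using assms by (simp add: dqp_def)
qed


section \<open>Packed words\<close>

definition packed_words :: "nat \<Rightarrow> nat list set" where
  "packed_words n = {w. length w = n \<and> (\<exists>r. set w = {1..r})}"

text \<open>List positions start at 0, whereas the letters of a word are numbered from 1.\<close>

definition dqp_of_word :: "nat list \<Rightarrow> dqp_struct" where
  "dqp_of_word w = \<lparr>verts = {1..length w},
     le1 = {(i, j). i \<in> {1..length w} \<and> j \<in> {1..length w} \<and> w ! (i - 1) \<le> w ! (j - 1)},
     le2 = {(i, j). i \<in> {1..length w} \<and> j \<in> {1..length w} \<and> i \<le> j}\<rparr>"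

lemma dqp_dqp_of_word: "dqp (dqp_of_word w)"
  by (auto simp: dqp_def dqp_of_word_def preorder_on_def refl_on_def intro!: transI)

definition KE :: "nat \<Rightarrow> 'k::field hdqp set" where
  "KE n = hvs.span ((\<lambda>w. basis_vec (iso_class (dqp_of_word w))) ` packed_words n)"


section \<open>Algebra isomorphisms\<close>

text \<open>Associative, not necessarily unital, algebras carried by a subspace \<open>A\<close>.\<close>

definition algebra_on ::
  "('b \<Rightarrow>\<^sub>0 'k::field) set \<Rightarrow> (('b \<Rightarrow>\<^sub>0 'k) \<Rightarrow> ('b \<Rightarrow>\<^sub>0 'k) \<Rightarrow> ('b \<Rightarrow>\<^sub>0 'k)) \<Rightarrow> bool" where
  "algebra_on A m \<longleftrightarrow> hvs.subspace A \<and>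
     (\<forall>x\<in>A. \<forall>y\<in>A. m x y \<in> A) \<and>
     (\<forall>x\<in>A. \<forall>y\<in>A. \<forall>z\<in>A. m (x + y) z = m x z + m y z \<and> m z (x + y) = m z x + m z y) \<and>
     (\<forall>c. \<forall>x\<in>A. \<forall>y\<in>A. m (hscale c x) y = hscale c (m x y) \<and> m x (hscale c y) = hscale c (m x y)) \<and>
     (\<forall>x\<in>A. \<forall>y\<in>A. \<forall>z\<in>A. m (m x y) z = m x (m y z))"

definition algebra_isomorphism ::
  "('b \<Rightarrow>\<^sub>0 'k::field) set \<Rightarrow> (('b \<Rightarrow>\<^sub>0 'k) \<Rightarrow> ('b \<Rightarrow>\<^sub>0 'k) \<Rightarrow> ('b \<Rightarrow>\<^sub>0 'k)) \<Rightarrow>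
   ('c \<Rightarrow>\<^sub>0 'k) set \<Rightarrow> (('c \<Rightarrow>\<^sub>0 'k) \<Rightarrow> ('c \<Rightarrow>\<^sub>0 'k) \<Rightarrow> ('c \<Rightarrow>\<^sub>0 'k)) \<Rightarrow>
   (('b \<Rightarrow>\<^sub>0 'k) \<Rightarrow> ('c \<Rightarrow>\<^sub>0 'k)) \<Rightarrow> bool" where
  "algebra_isomorphism A m B m' f \<longleftrightarrow> algebra_on A m \<and> algebra_on B m' \<and>
     bij_betw f A B \<and>
     (\<forall>x\<in>A. \<forall>y\<in>A. f (x + y) = f x + f y) \<and>
     (\<forall>c. \<forall>x\<in>A. f (hscale c x) = hscale c (f x)) \<and>
     (\<forall>x\<in>A. \<forall>y\<in>A. f (m x y) = m' (f x) (f y))"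

end

theory Submission
  imports Defs
begin

text \<open>Identifying packed words with total preorders on \<open>{1..n}\<close>, the blow ups of \<open>t\<close> are its total
  refinements, so \<open>\<Upsilon>\<close> is unitriangular for inclusion, hence bijective. A permutation
  \<open>f\<close> lies in \<open>I_<(P_s, P_t)\<close> iff the total order it pulls back refines \<open>s\<close>, and in \<open>I(P_s, P_t)\<close>
  iff that order equals \<open>s\<close>; as pulling back along \<open>f\<close> commutes with refinement, multiplicativity
  follows.\<close>

section \<open>Linear extensions\<close>

text \<open>Expanding \<open>upsilon (prod_lhd (tvec n s) (tvec n t))\<close> gives a double sum of
  \<open>tvec n (pullback n f t')\<close> over permutations \<open>f\<close> whose pulled-back order
  refines \<open>s\<close> and over refinements \<open>t'\<close> of \<open>t\<close>. Sorting the
  \<open>f\<close> by the order they pull back turns it into the sum of the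
  \<open>prod_unlhd\<close> products of all refinements of \<open>s\<close> with all refinements of
  \<open>t\<close>; a refinement of \<open>s\<close> with ties contributes nothing, since pulling
  back a linear order along a permutation never creates ties. Basis vectors are isomorphism classes,
  so injectivity also needs distinct preorders to stay non-isomorphic: the second relation is a
  linear order, which leaves the identity as the only possible isomorphism. Associativity is part of
  the notion of algebra isomorphism used here; it is proved for all double quasi-posets, by one
  argument for both products, which differ only in the set of maps summed over.\<close>

lemma linear_ext_superset:
  assumes "finite A" "Poly_Mapping.keys x \<subseteq> A"
  shows "linear_ext f x = (\<Sum>b\<in>A. hscale (Poly_Mapping.lookup x b) (f b))"
  unfolding linear_ext_def using assms
  by (intro sum.mono_neutral_left) (auto simp: in_keys_iff)

text \<open>Cancellation can make the support of \<open>x + y\<close> smaller than the union of the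
  two supports, so all three sums are first extended to that union.\<close>

lemma linear_ext_add: "linear_ext f (x + y) = linear_ext f x + linear_ext f y"
proof -
  let ?A = "Poly_Mapping.keys x \<union> Poly_Mapping.keys y"
  have "finite ?A" by simp
  moreover have "Poly_Mapping.keys (x + y) \<subseteq> ?A" by (rule keys_add)
  ultimately show ?thesis
    by (simp add: linear_ext_superset[of ?A] lookup_add hvs.scale_left_distrib sum.distrib)
qed

lemma linear_ext_scale: "linear_ext f (hscale c x) = hscale c (linear_ext f x)"
proof -
  have "Poly_Mapping.keys (hscale c x) \<subseteq> Poly_Mapping.keys x" by (auto simp: in_keys_iff)
  then show ?thesis
    by (simp add: linear_ext_superset[of "Poly_Mapping.keys x"] hvs.scale_sum_right)
qed

definition lin :: "(('b \<Rightarrow>\<^sub>0 'k::field) \<Rightarrow> ('c \<Rightarrow>\<^sub>0 'k)) \<Rightarrow> bool" where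
  "lin L \<longleftrightarrow> (\<forall>x y. L (x + y) = L x + L y) \<and> (\<forall>c x. L (hscale c x) = hscale c (L x))"

lemma lin_add: "lin L \<Longrightarrow> L (x + y) = L x + L y"
  and lin_scale: "lin L \<Longrightarrow> L (hscale c x) = hscale c (L x)"
  by (simp_all add: lin_def)

lemma lin_0: "lin L \<Longrightarrow> L 0 = 0"
  using lin_scale[of L 0 0] by simp

lemma lin_sum: "lin L \<Longrightarrow> L (sum g A) = (\<Sum>a\<in>A. L (g a))"
  by (induction A rule: infinite_finite_induct) (simp_all add: lin_0 lin_add)

lemma lin_diff: "lin L \<Longrightarrow> L (x - y) = L x - L y"
  using lin_add[of L "x - y" y] by simp

lemma lin_compose: "lin L \<Longrightarrow> lin M \<Longrightarrow> lin (\<lambda>x. L (M x))"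
  by (simp add: lin_def)

lemma lin_linear_ext: "lin (linear_ext f)"
  by (simp add: lin_def linear_ext_add linear_ext_scale)

text \<open>This is the expansion of \<open>x\<close> in the basis; applying a linear map to it
  shows that the map is determined by its values on basis vectors.\<close>

lemma linear_ext_basis_vec: "linear_ext basis_vec x = x"
proof (rule poly_mapping_eqI)
  fix k
  have "Poly_Mapping.lookup (linear_ext basis_vec x) k =
      (\<Sum>b\<in>Poly_Mapping.keys x. if b = k then Poly_Mapping.lookup x b else 0)"
    unfolding linear_ext_def lookup_sum
    by (intro sum.cong) (auto simp: basis_vec_def lookup_single when_def)
  then show "Poly_Mapping.lookup (linear_ext basis_vec x) k = Poly_Mapping.lookup x k"
    by (auto simp: in_keys_iff)
qed

lemma lin_eqI:
  assumes L: "lin L" and M: "lin M" and eq: "\<And>b. L (basis_vec b) = M (basis_vec b)"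
  shows "L x = M x"
proof -
  have "N (linear_ext basis_vec x) =
      (\<Sum>b\<in>Poly_Mapping.keys x. hscale (Poly_Mapping.lookup x b) (N (basis_vec b)))"
    if "lin N" for N :: "('a \<Rightarrow>\<^sub>0 'b) \<Rightarrow> ('c \<Rightarrow>\<^sub>0 'b)"
    unfolding linear_ext_def by (simp add: lin_sum[OF that] lin_scale[OF that])
  from this[OF L] this[OF M] eq show ?thesis by (simp add: linear_ext_basis_vec)
qed

lemma subspace_vimage_lin:
  assumes "lin L" "hvs.subspace S"
  shows "hvs.subspace {x. L x \<in> S}"
  using assms by (auto simp: hvs.subspace_def lin_add lin_scale lin_0)

lemma subspace_image_lin:
  assumes L: "lin L" and S: "hvs.subspace S"
  shows "hvs.subspace (L ` S)"
proof (rule hvs.subspaceI)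
  show "0 \<in> L ` S" using lin_0[OF L] hvs.subspace_0[OF S] by (metis imageI)
  fix x y assume "x \<in> L ` S" "y \<in> L ` S"
  then show "x + y \<in> L ` S" using lin_add[OF L] hvs.subspace_add[OF S] by (auto simp flip: lin_add[OF L])
next
  fix c x assume "x \<in> L ` S"
  then show "hscale c x \<in> L ` S" using hvs.subspace_scale[OF S] by (auto simp flip: lin_scale[OF L])
qed

lemma lin_span_subset:
  assumes "lin L" "hvs.subspace S" "\<And>b. b \<in> B \<Longrightarrow> L b \<in> S" "x \<in> hvs.span B"
  shows "L x \<in> S"
  using hvs.span_minimal[of B "{x. L x \<in> S}"] subspace_vimage_lin[OF assms(1,2)] assms(3,4) by blast

lemma lin_span_eq:
  assumes L: "lin L" and M: "lin M" and "\<And>b. b \<in> B \<Longrightarrow> L b = M b" "x \<in> hvs.span B"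
  shows "L x = M x"
proof -
  have "hvs.subspace {x. L x = M x}"
    by (simp add: hvs.subspace_def lin_add[OF L] lin_add[OF M] lin_scale[OF L] lin_scale[OF M]
        lin_0[OF L] lin_0[OF M])
  then show ?thesis using hvs.span_minimal[of B "{x. L x = M x}"] assms(3,4) by blast
qed

lemma bilinear_ext_left:
  "bilinear_ext m x y = linear_ext (\<lambda>b. linear_ext (m b) y) x"
  by (simp add: bilinear_ext_def linear_ext_def hvs.scale_sum_right)

lemma bilinear_ext_right:
  "bilinear_ext m x y = linear_ext (\<lambda>c. linear_ext (\<lambda>b. m b c) x) y"
  unfolding bilinear_ext_def linear_ext_def
  by (subst sum.swap) (simp add: hvs.scale_sum_right mult.commute)

lemma lin_bilinear_ext_left: "lin (\<lambda>x. bilinear_ext m x y)"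
  unfolding bilinear_ext_left by (rule lin_linear_ext)

lemma lin_bilinear_ext_right: "lin (bilinear_ext m x)"
  unfolding bilinear_ext_right by (rule lin_linear_ext)

text \<open>Both sides are linear in each argument, so basis vectors are replaced by arbitrary ones
  one argument at a time: \<open>z\<close>, then \<open>y\<close>, then \<open>x\<close>.\<close>

lemma bilinear_ext_assoc:
  assumes "\<And>a b c. bilinear_ext m (m a b) (basis_vec c) = bilinear_ext m (basis_vec a) (m b c)"
  shows "bilinear_ext m (bilinear_ext m x y) z = bilinear_ext m x (bilinear_ext m y z)"
proof -
  note l = lin_bilinear_ext_left[of m] and r = lin_bilinear_ext_right[of m]
  have 1: "bilinear_ext m (m a b) z = bilinear_ext m (basis_vec a) (bilinear_ext m (basis_vec b) z)" for a b z
    by (rule lin_eqI[OF r lin_compose[OF r r]]) (simp add: assms bilinear_ext_basis)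
  have 2: "bilinear_ext m (bilinear_ext m (basis_vec a) y) z =
      bilinear_ext m (basis_vec a) (bilinear_ext m y z)" for a y z
    by (rule lin_eqI[OF lin_compose[OF l r] lin_compose[OF r l]]) (simp add: 1 bilinear_ext_basis)
  show ?thesis
    by (rule lin_eqI[OF lin_compose[OF l l] l]) (simp add: 2)
qed

text \<open>Closure is checked on generators and spreads by linearity, first in the second argument,
  then in the first; associativity is inherited from the whole space.\<close>

lemma algebra_on_span:
  assumes assoc: "\<And>a b c. bilinear_ext m (m a b) (basis_vec c) = bilinear_ext m (basis_vec a) (m b c)"
    and closed: "\<And>b c. b \<in> B \<Longrightarrow> c \<in> B \<Longrightarrow> bilinear_ext m b c \<in> hvs.span B"
  shows "algebra_on (hvs.span B) (bilinear_ext m)"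
proof -
  have 1: "bilinear_ext m b y \<in> hvs.span B" if "b \<in> B" "y \<in> hvs.span B" for b y
    using lin_span_subset[OF lin_bilinear_ext_right hvs.subspace_span, of B m b B] that closed by blast
  have "bilinear_ext m x y \<in> hvs.span B" if "x \<in> hvs.span B" "y \<in> hvs.span B" for x y
    using lin_span_subset[OF lin_bilinear_ext_left hvs.subspace_span, of B m y B] that 1 by blast
  then show ?thesis
    unfolding algebra_on_def
    by (auto simp: bilinear_ext_assoc[OF assoc] lin_add[OF lin_bilinear_ext_left]
        lin_add[OF lin_bilinear_ext_right] lin_scale[OF lin_bilinear_ext_left] lin_scale[OF lin_bilinear_ext_right])
qed


section \<open>Associativity of the two products\<close>

text \<open>The quotient is partial: a representative is related to itself by
  \<open>dqp_iso\<close>, and this already contains \<open>dqp\<close>.\<close>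

lemma dqp_class_exhaust:
  obtains P where "dqp P" "c = iso_class P"
  by (metis Quotient3_dqp_class Quotient3_def dqp_iso_def)

lemma I_le_subset: "I_le P Q \<subseteq> I_lt P Q"
  by (auto simp: I_le_def)

lemma I_ltD:
  assumes "f \<in> I_lt P Q"
  shows "f \<in> extensional (verts P)" "bij_betw f (verts P) (verts Q)"
  using assms by (simp_all add: I_lt_def)

text \<open>Both conditions consult only the vertices and the second relation of the target, which
  twisting leaves alone.\<close>

lemma I_twist_right:
  "I_lt P (twist Q h R) = I_lt P Q" "I_le P (twist Q h R) = I_le P Q"
  by (simp_all add: I_lt_def I_le_def twist_def)

lemma twist_twist:
  assumes "f \<in> I_lt P Q"
  shows "twist (twist P f Q) (compose (verts P) h f) R = twist P f (twist Q h R)"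
  using bij_betwE[OF I_ltD(2)[OF assms]] by (auto simp: twist_def compose_def)

text \<open>The first relation of \<open>twist P f Q\<close> is that of \<open>Q\<close> read
  through \<open>f\<close>, so composing with \<open>f\<close> carries the conditions on maps out of
  \<open>Q\<close> to those on maps out of the twist. Composition with the inverse of
  \<open>f\<close> goes back; \<open>compose\<close> keeps the maps extensional.\<close>

lemma I_twist_left:
  assumes f: "f \<in> I_lt P Q" and S: "S = I_lt \<or> S = I_le"
  shows "bij_betw (\<lambda>h. compose (verts P) h f) (S Q R) (S (twist P f Q) R)"
proof -
  have fb: "bij_betw f (verts P) (verts Q)" using I_ltD[OF f] by simp
  let ?k = "inv_into (verts P) f"
  have kb: "bij_betw ?k (verts Q) (verts P)" using fb by (rule bij_betw_inv_into)
  have fv: "\<And>x. x \<in> verts P \<Longrightarrow> f x \<in> verts Q" and kv: "\<And>x. x \<in> verts Q \<Longrightarrow> ?k x \<in> verts P"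
    using fb kb by (auto dest: bij_betwE)
  have fk: "\<And>x. x \<in> verts Q \<Longrightarrow> f (?k x) = x" and kf: "\<And>x. x \<in> verts P \<Longrightarrow> ?k (f x) = x"
    using fb by (auto simp: bij_betw_inv_into_right bij_betw_inv_into_left)
  have cb: "bij_betw (compose A g f) A C" if "bij_betw f A B" "bij_betw g B C"
    for A B C and f g :: "nat \<Rightarrow> nat"
  proof -
    have "bij_betw (g \<circ> f) A C" using that by (rule bij_betw_trans)
    then show ?thesis by (rule bij_betw_cong[THEN iffD1, rotated]) (simp add: compose_def)
  qed
  show ?thesis
  proof (rule bij_betw_byWitness[where f' = "\<lambda>g. compose (verts Q) g ?k"])
    show "\<forall>h\<in>S Q R. compose (verts Q) (compose (verts P) h f) ?k = h"
    proof
      fix h assume "h \<in> S Q R"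
      then have "h \<in> extensional (verts Q)" using S I_le_subset I_ltD(1) by blast
      then show "compose (verts Q) (compose (verts P) h f) ?k = h"
        by (rule extensionalityI[rotated]) (simp_all add: compose_def kv fk)
    qed
    show "\<forall>g\<in>S (twist P f Q) R. compose (verts P) (compose (verts Q) g ?k) f = g"
    proof
      fix g assume "g \<in> S (twist P f Q) R"
      then have "g \<in> extensional (verts (twist P f Q))" using S I_le_subset I_ltD(1) by blast
      then have "g \<in> extensional (verts P)" by (simp add: twist_def)
      then show "compose (verts P) (compose (verts Q) g ?k) f = g"
        by (rule extensionalityI[rotated]) (simp_all add: compose_def fv kf)
    qed
    show "(\<lambda>h. compose (verts P) h f) ` S Q R \<subseteq> S (twist P f Q) R"
      using S cb[OF fb]
      by (auto simp: I_lt_def I_le_def twist_def compose_def strictly_def sim_def fv)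
    show "(\<lambda>g. compose (verts Q) g ?k) ` S (twist P f Q) R \<subseteq> S Q R"
      using S cb[OF kb]
      by (auto simp: I_lt_def I_le_def twist_def compose_def strictly_def sim_def kv fk)
  qed
qed

text \<open>By the two descriptions of maps into and out of a twist, both sides run over pairs
  \<open>(f, h)\<close> in \<open>S P Q\<close> and \<open>S Q R\<close>, and
  \<open>twist_twist\<close> identifies the summands.\<close>

lemma sum_twist_assoc:
  assumes S: "S = I_lt \<or> S = I_le"
  shows "(\<Sum>f\<in>S P Q. \<Sum>g\<in>S (twist P f Q) R. b (twist (twist P f Q) g R)) =
    (\<Sum>h\<in>S Q R. \<Sum>f\<in>S P (twist Q h R). b (twist P f (twist Q h R)))"
proof -
  have "(\<Sum>g\<in>S (twist P f Q) R. b (twist (twist P f Q) g R)) =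
      (\<Sum>h\<in>S Q R. b (twist P f (twist Q h R)))" if "f \<in> S P Q" for f
  proof -
    have f: "f \<in> I_lt P Q" using that S I_le_subset by blast
    show ?thesis
      by (subst sum.reindex_bij_betw[OF I_twist_left[OF f S], symmetric])
        (simp add: twist_twist[OF f])
  qed
  moreover have "S P (twist Q h R) = S P Q" for h using S I_twist_right by auto
  ultimately show ?thesis by (simp add: sum.swap[of _ "S Q R"])
qed

lemma dqp_twist_I_lt: "dqp P \<Longrightarrow> dqp Q \<Longrightarrow> f \<in> I_lt P Q \<Longrightarrow> dqp (twist P f Q)"
  by (rule dqp_twist) (auto dest: I_ltD)

lemma lhd_class_assoc:
  "bilinear_ext lhd_class (lhd_class a b) (basis_vec c) =
   bilinear_ext lhd_class (basis_vec a) (lhd_class b c :: 'k::field hdqp)"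
proof -
  obtain P Q R where d: "dqp P" "dqp Q" "dqp R"
    and [simp]: "a = iso_class P" "b = iso_class Q" "c = iso_class R"
    using dqp_class_exhaust by metis
  note basis = prod_lhd_basis[unfolded prod_lhd_def bilinear_ext_basis, where 'a='k] dqp_twist_I_lt
  have 1: "bilinear_ext lhd_class (lhd_class a b) (basis_vec c) =
      (\<Sum>f\<in>I_lt P Q. \<Sum>g\<in>I_lt (twist P f Q) R.
        basis_vec (iso_class (twist (twist P f Q) g R)) :: 'k hdqp)"
    using d
    by (simp add: bilinear_ext_basis lin_sum[OF lin_bilinear_ext_left] basis)
  have 2: "bilinear_ext lhd_class (basis_vec a) (lhd_class b c) =
      (\<Sum>h\<in>I_lt Q R. \<Sum>f\<in>I_lt P (twist Q h R).
        basis_vec (iso_class (twist P f (twist Q h R))) :: 'k hdqp)"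
    using d
    by (simp add: bilinear_ext_basis lin_sum[OF lin_bilinear_ext_right] basis)
  show ?thesis unfolding 1 2 by (rule sum_twist_assoc) simp
qed

lemma unlhd_class_assoc:
  "bilinear_ext unlhd_class (unlhd_class a b) (basis_vec c) =
   bilinear_ext unlhd_class (basis_vec a) (unlhd_class b c :: 'k::field hdqp)"
proof -
  obtain P Q R where d: "dqp P" "dqp Q" "dqp R"
    and [simp]: "a = iso_class P" "b = iso_class Q" "c = iso_class R"
    using dqp_class_exhaust by metis
  note basis = prod_unlhd_basis[unfolded prod_unlhd_def bilinear_ext_basis, where 'a='k]
    dqp_twist_I_lt[OF _ _ subsetD[OF I_le_subset]]
  have 1: "bilinear_ext unlhd_class (unlhd_class a b) (basis_vec c) =
      (\<Sum>f\<in>I_le P Q. \<Sum>g\<in>I_le (twist P f Q) R.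
        basis_vec (iso_class (twist (twist P f Q) g R)) :: 'k hdqp)"
    using d
    by (simp add: bilinear_ext_basis lin_sum[OF lin_bilinear_ext_left] basis)
  have 2: "bilinear_ext unlhd_class (basis_vec a) (unlhd_class b c) =
      (\<Sum>h\<in>I_le Q R. \<Sum>f\<in>I_le P (twist Q h R).
        basis_vec (iso_class (twist P f (twist Q h R))) :: 'k hdqp)"
    using d
    by (simp add: bilinear_ext_basis lin_sum[OF lin_bilinear_ext_right] basis)
  show ?thesis unfolding 1 2 by (rule sum_twist_assoc) simp
qed


section \<open>Blow ups of total preorders\<close>

text \<open>Inside a class of equivalent vertices all pairs are already present, so replacing the
  relation there can only remove pairs.\<close>

lemma elementary_blow_up_le1:
  assumes e: "elementary_blow_up P P'" and d: "dqp P"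
  shows "le1 P' \<subseteq> le1 P"
  using e
proof cases
  case (1 i r)
  have "r \<subseteq> sim_class P i \<times> sim_class P i"
    using 1(4) by (auto simp: total_preorder_on_def preorder_on_def)
  moreover have "(x, y) \<in> le1 P" if "x \<in> sim_class P i" "y \<in> sim_class P i" for x y
    using that d preorder_onD(3)[of "verts P" "le1 P" x i y]
    by (auto simp: sim_class_def sim_def dqp_def)
  ultimately show ?thesis using 1(1) by (auto simp: blow_up_along_def split: if_splits)
qed

lemma elementary_blow_up_total:
  assumes e: "elementary_blow_up P P'" and t: "total_on (verts P) (le1 P)"
  shows "total_on (verts P') (le1 P')"
  using e
proof cases
  case (1 i r)
  have "total_on (sim_class P i) r" using 1(4) by (simp add: total_preorder_on_def)
  then show ?thesis using t 1(1) by (auto simp: total_on_def blow_up_along_def)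
qed

lemma total_preorder_on_cases:
  assumes "total_preorder_on A r" "x \<in> A" "y \<in> A"
  shows "(x, y) \<in> r \<or> (y, x) \<in> r"
  using assms by (cases "x = y") (auto simp: total_preorder_on_def total_on_def preorder_on_def refl_on_def)

text \<open>Induction on the number of pairs still to be removed: while some pair is in excess, one
  equivalence class can be given its final shape, the restriction of \<open>s\<close>.\<close>

lemma blow_ups_total_preorderI:
  assumes "dqp P" "total_on (verts P) (le1 P)" "total_preorder_on (verts P) s" "s \<subseteq> le1 P"
  shows "P\<lparr>le1 := s\<rparr> \<in> blow_ups P"
  using assms
proof (induction "card (le1 P - s)" arbitrary: P rule: less_induct)
  case less
  note d = less.prems(1)
  have fin: "finite (le1 P)"
    by (rule finite_subset[of _ "verts P \<times> verts P"]) (use d dqp_subset[OF d] in \<open>auto simp: dqp_def\<close>)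
  show ?case
  proof (cases "s = le1 P")
    case True
    then show ?thesis by (simp add: blow_ups_def)
  next
    case False
    then obtain i j where ij: "(i, j) \<in> le1 P" "(i, j) \<notin> s" using less.prems(4) by auto
    then have V: "i \<in> verts P" "j \<in> verts P" using dqp_subset[OF d] by auto
    have s: "preorder_on (verts P) s" using less.prems(3) by (simp add: total_preorder_on_def)
    \<comment> \<open>Totality of \<open>s\<close> puts the reversed pair into \<open>s\<close>,
      hence into \<open>le1 P\<close>; so \<open>i\<close> and \<open>j\<close> are equivalent in
      \<open>P\<close>, and the class of \<open>i\<close> is not a singleton.\<close>
    have ji: "(j, i) \<in> s" using total_preorder_on_cases[OF less.prems(3) V] ij by auto
    have "i \<noteq> j" using ij ji by auto
    let ?C = "sim_class P i"
    have C: "?C \<subseteq> verts P" by (auto simp: sim_class_def)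
    have jC: "j \<in> ?C" using ij ji V less.prems(4) by (auto simp: sim_class_def sim_def)
    have iC: "i \<in> ?C" using V d by (auto simp: sim_class_def sim_def dqp_def dest: preorder_onD(2))
    define r where "r = s \<inter> ?C \<times> ?C"
    have "total_preorder_on ?C r"
      using s total_preorder_on_cases[OF less.prems(3)] C
      unfolding r_def total_preorder_on_def preorder_on_def refl_on_def total_on_def
      by (auto intro!: transI dest: transD)
    then have e: "elementary_blow_up P (blow_up_along P i r)"
      using V jC \<open>i \<noteq> j\<close> by (intro elementary_blow_up.intros) auto
    let ?P = "blow_up_along P i r"
    have v: "verts ?P = verts P" using elementary_blow_up_verts[OF e] by simp
    have sub: "le1 ?P \<subseteq> le1 P" using elementary_blow_up_le1[OF e d] .
    have sP: "s \<subseteq> le1 ?P" using less.prems(4) by (auto simp: blow_up_along_def r_def)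
    have "(i, j) \<notin> le1 ?P" using iC jC ij by (auto simp: blow_up_along_def r_def)
    then have "le1 ?P - s \<subset> le1 P - s" using sub ij by auto
    then have "card (le1 ?P - s) < card (le1 P - s)" using fin by (simp add: psubset_card_mono)
    then have "?P\<lparr>le1 := s\<rparr> \<in> blow_ups ?P"
      using elementary_blow_up_dqp[OF e d] elementary_blow_up_total[OF e less.prems(2)] v sP less.prems(3)
      by (intro less.hyps) simp_all
    moreover have "?P\<lparr>le1 := s\<rparr> = P\<lparr>le1 := s\<rparr>" by (simp add: blow_up_along_def)
    ultimately show ?thesis
      using e by (auto simp: blow_ups_def intro: converse_rtranclp_into_rtranclp)
  qed
qed

text \<open>One inclusion is \<open>blow_ups_total_preorderI\<close>; the other holds because every
  elementary step keeps totality and only removes pairs.\<close>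

lemma blow_ups_total_preorder:
  assumes d: "dqp P" and t: "total_on (verts P) (le1 P)"
  shows "blow_ups P = (\<lambda>s. P\<lparr>le1 := s\<rparr>) ` {s. total_preorder_on (verts P) s \<and> s \<subseteq> le1 P}"
proof
  show "(\<lambda>s. P\<lparr>le1 := s\<rparr>) ` {s. total_preorder_on (verts P) s \<and> s \<subseteq> le1 P} \<subseteq> blow_ups P"
    using blow_ups_total_preorderI[OF d t] by auto
  show "blow_ups P \<subseteq> (\<lambda>s. P\<lparr>le1 := s\<rparr>) ` {s. total_preorder_on (verts P) s \<and> s \<subseteq> le1 P}"
  proof
    fix X assume X: "X \<in> blow_ups P"
    note b = blow_ups_dqp[OF X d]
    have "elementary_blow_up\<^sup>*\<^sup>* P X" using X by (simp add: blow_ups_def)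
    then have "dqp X \<and> total_on (verts X) (le1 X) \<and> le1 X \<subseteq> le1 P"
    proof (induction rule: rtranclp_induct)
      case base
      then show ?case using d t by simp
    next
      case (step y z)
      then show ?case
        using elementary_blow_up_dqp elementary_blow_up_total elementary_blow_up_le1 by blast
    qed
    with b have "total_preorder_on (verts P) (le1 X)" "le1 X \<subseteq> le1 P"
      by (auto simp: total_preorder_on_def dqp_def)
    moreover have "X = P\<lparr>le1 := le1 X\<rparr>" using b by simp
    ultimately show "X \<in> (\<lambda>s. P\<lparr>le1 := s\<rparr>) ` {s. total_preorder_on (verts P) s \<and> s \<subseteq> le1 P}"
      by blast
  qed
qed


section \<open>Packed words as total preorders\<close>

abbreviation tpo :: "nat \<Rightarrow> nat rel set" where
  "tpo n \<equiv> {t. total_preorder_on {1..n} t}"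

definition std_le :: "nat \<Rightarrow> nat rel" where
  "std_le n = {(i, j). i \<in> {1..n} \<and> j \<in> {1..n} \<and> i \<le> j}"

text \<open>This is the form of \<open>dqp_of_word\<close>, in which the word enters only through
  the preorder that its letters induce on the positions.\<close>

definition std_dqp :: "nat \<Rightarrow> nat rel \<Rightarrow> dqp_struct" where
  "std_dqp n t = \<lparr>verts = {1..n}, le1 = t, le2 = std_le n\<rparr>"

lemma std_dqp_simps [simp]:
  "verts (std_dqp n t) = {1..n}" "le1 (std_dqp n t) = t" "le2 (std_dqp n t) = std_le n"
  by (simp_all add: std_dqp_def)

abbreviation tvec :: "nat \<Rightarrow> nat rel \<Rightarrow> 'k::field hdqp" where
  "tvec n t \<equiv> basis_vec (iso_class (std_dqp n t))"

lemma finite_tpo: "finite (tpo n)"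
  by (rule finite_subset[of _ "Pow ({1..n} \<times> {1..n})"])
    (auto simp: total_preorder_on_def preorder_on_def)

lemma dqp_std_dqp: "t \<in> tpo n \<Longrightarrow> dqp (std_dqp n t)"
  by (auto simp: dqp_def total_preorder_on_def std_le_def preorder_on_def refl_on_def intro!: transI)

text \<open>An order automorphism maps the initial segment \<open>{1..i}\<close> onto
  \<open>{1..g i}\<close>, and the two have the same cardinality.\<close>

lemma order_automorphism_interval:
  assumes b: "bij_betw g {1..n} {1..n::nat}"
    and m: "\<And>i j. i \<in> {1..n} \<Longrightarrow> j \<in> {1..n} \<Longrightarrow> g i \<le> g j \<longleftrightarrow> i \<le> j"
    and i: "i \<in> {1..n}"
  shows "g i = i"
proof -
  have gi: "g i \<in> {1..n}" using b i by (auto dest: bij_betwE)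
  have "g ` {1..i} = {1..g i}"
  proof
    show "g ` {1..i} \<subseteq> {1..g i}" using b i m by (auto dest: bij_betwE)
    show "{1..g i} \<subseteq> g ` {1..i}"
    proof
      fix y assume y: "y \<in> {1..g i}"
      then have "y \<in> g ` {1..n}" using gi b by (auto simp: bij_betw_def)
      then obtain x where "x \<in> {1..n}" "y = g x" by auto
      with y i m[of x i] show "y \<in> g ` {1..i}" by auto
    qed
  qed
  moreover have "inj_on g {1..i}" using b i by (auto simp: bij_betw_def intro: inj_on_subset)
  ultimately have "card {1..i} = card {1..g i}" by (metis card_image)
  then show ?thesis by simp
qed

text \<open>An isomorphism preserves the linear second relation, hence is the identity on
  \<open>{1..n}\<close>, and so the first relations agree.\<close>

lemma iso_class_std_dqp_eq_iff:
  assumes t: "t \<in> tpo n" and u: "u \<in> tpo n"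
  shows "iso_class (std_dqp n t) = iso_class (std_dqp n u) \<longleftrightarrow> t = u"
proof
  assume "iso_class (std_dqp n t) = iso_class (std_dqp n u)"
  then have "dqp_iso (std_dqp n t) (std_dqp n u)"
    using Quotient3_rel[OF Quotient3_dqp_class] dqp_iso_refl[OF dqp_std_dqp] t u by blast
  then obtain g where "dqp_isomorphism (std_dqp n t) (std_dqp n u) g" by (auto simp: dqp_iso_def)
  then have b: "bij_betw g {1..n} {1..n}"
    and tu: "\<And>i j. i \<in> {1..n} \<Longrightarrow> j \<in> {1..n} \<Longrightarrow> (i, j) \<in> t \<longleftrightarrow> (g i, g j) \<in> u"
    and le: "\<And>i j. i \<in> {1..n} \<Longrightarrow> j \<in> {1..n} \<Longrightarrow> (i, j) \<in> std_le n \<longleftrightarrow> (g i, g j) \<in> std_le n"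
    unfolding dqp_isomorphism_def std_dqp_simps by blast+
  have "g i = i" if "i \<in> {1..n}" for i
  proof (rule order_automorphism_interval[OF b _ that])
    fix i j assume "i \<in> {1..n}" "j \<in> {1..n}"
    then show "g i \<le> g j \<longleftrightarrow> i \<le> j"
      using le[of i j] bij_betwE[OF b] by (auto simp: std_le_def)
  qed
  with tu have *: "(i, j) \<in> t \<longleftrightarrow> (i, j) \<in> u" if "i \<in> {1..n}" "j \<in> {1..n}" for i j
    using that by metis
  have "t \<subseteq> {1..n} \<times> {1..n}" "u \<subseteq> {1..n} \<times> {1..n}"
    using t u by (auto simp: total_preorder_on_def preorder_on_def)
  with * show "t = u" by (intro set_eqI) (metis SigmaD1 SigmaD2 subsetD surj_pair)
qed simp

text \<open>The rank map closes the gaps in a finite set of numbers; it is strictly increasing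
  because each larger element counts itself.\<close>

lemma card_rank_image:
  assumes "finite (S :: nat set)"
  shows "(\<lambda>x. card {y \<in> S. y \<le> x}) ` S = {1..card S}"
    and "x \<in> S \<Longrightarrow> x' \<in> S \<Longrightarrow> card {y \<in> S. y \<le> x} \<le> card {y \<in> S. y \<le> x'} \<longleftrightarrow> x \<le> x'"
proof -
  let ?c = "\<lambda>x. card {y \<in> S. y \<le> x}"
  have lt: "?c x < ?c x'" if "x' \<in> S" "x < x'" for x x'
  proof (rule psubset_card_mono)
    show "finite {y \<in> S. y \<le> x'}" using assms by simp
    show "{y \<in> S. y \<le> x} \<subset> {y \<in> S. y \<le> x'}"
      using that by (auto simp: psubset_eq dest!: equalityD2)
  qed
  show "?c x \<le> ?c x' \<longleftrightarrow> x \<le> x'" if "x \<in> S" "x' \<in> S" for x x'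
    using lt[of x x'] lt[of x' x] that by (cases x x' rule: linorder_cases) auto
  have "inj_on ?c S"
  proof (rule inj_onI)
    fix x x' assume "x \<in> S" "x' \<in> S" "?c x = ?c x'"
    then show "x = x'" using lt[of x x'] lt[of x' x] by (cases x x' rule: linorder_cases) auto
  qed
  then have "card (?c ` S) = card S" by (rule card_image)
  moreover have "?c ` S \<subseteq> {1..card S}"
  proof
    fix z assume "z \<in> ?c ` S"
    then obtain x where x: "x \<in> S" "z = ?c x" by auto
    have "0 < ?c x" using assms x by (auto simp: card_gt_0_iff)
    moreover have "?c x \<le> card S" using assms by (intro card_mono) auto
    ultimately show "z \<in> {1..card S}" using x by simp
  qed
  ultimately show "?c ` S = {1..card S}" by (intro card_subset_eq) auto
qed

lemma dqp_of_word_packed: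
  "dqp_of_word ` packed_words n = std_dqp n ` tpo n"
proof
  show "dqp_of_word ` packed_words n \<subseteq> std_dqp n ` tpo n"
  proof
    fix P assume "P \<in> dqp_of_word ` packed_words n"
    then obtain w where w: "length w = n" "P = dqp_of_word w" by (auto simp: packed_words_def)
    then have "P = std_dqp n (le1 P)" by (simp add: dqp_of_word_def std_dqp_def std_le_def)
    moreover have "le1 P \<in> tpo n"
      using w dqp_dqp_of_word[of w]
      by (auto simp: dqp_of_word_def dqp_def total_preorder_on_def total_on_def)
    ultimately show "P \<in> std_dqp n ` tpo n" by blast
  qed
  show "std_dqp n ` tpo n \<subseteq> dqp_of_word ` packed_words n"
  proof
    fix P assume "P \<in> std_dqp n ` tpo n"
    then obtain t where t: "total_preorder_on {1..n} t" and P: "P = std_dqp n t" by auto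
    have p: "preorder_on {1..n} t" using t by (simp add: total_preorder_on_def)
    \<comment> \<open>The size of the down-set of \<open>i\<close> represents \<open>t\<close>
      numerically: by totality, a failure of \<open>(i, j) \<in> t\<close> makes the down-set of
      \<open>j\<close> a proper subset of that of \<open>i\<close>.\<close>
    define h where "h i = card {k. (k, i) \<in> t}" for i
    have fin: "finite {k. (k, i) \<in> t}" for i
      by (rule finite_subset[of _ "{1..n}"]) (use preorder_onD(1)[OF p] in auto)
    have mono: "{k. (k, i) \<in> t} \<subseteq> {k. (k, j) \<in> t}" if "(i, j) \<in> t" for i j
      using preorder_onD(3)[OF p] that by blast
    have h: "h i \<le> h j \<longleftrightarrow> (i, j) \<in> t" if ij: "i \<in> {1..n}" "j \<in> {1..n}" for i j
    proof
      show "(i, j) \<in> t \<Longrightarrow> h i \<le> h j" unfolding h_def using mono fin by (intro card_mono) auto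
      show "h i \<le> h j \<Longrightarrow> (i, j) \<in> t"
      proof (rule ccontr)
        assume le: "h i \<le> h j" and n: "(i, j) \<notin> t"
        then have "(j, i) \<in> t" using total_preorder_on_cases[OF t ij] by auto
        then have "{k. (k, j) \<in> t} \<subset> {k. (k, i) \<in> t}"
          using mono n preorder_onD(2)[OF p ij(1)] by blast
        then have "h j < h i" unfolding h_def using fin by (intro psubset_card_mono)
        with le show False by simp
      qed
    qed
    define S where "S = h ` {1..n}"
    have S: "finite S" by (simp add: S_def)
    \<comment> \<open>Ties make \<open>h\<close> skip values, so its values are replaced by their
      ranks to obtain a packed word.\<close>
    define c where "c x = card {y \<in> S. y \<le> x}" for x
    define w where "w = map (\<lambda>i. c (h i)) [1..<n+1]"
    have len: "length w = n" by (simp add: w_def)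
    have "set w = c ` S" unfolding w_def S_def by (auto simp: image_image)
    also have "\<dots> = {1..card S}" unfolding c_def by (rule card_rank_image(1)[OF S])
    finally have "w \<in> packed_words n" using len by (auto simp: packed_words_def)
    moreover have nth: "w ! (i - 1) = c (h i)" if "i \<in> {1..n}" for i
      using that by (auto simp: w_def simp del: upt_Suc)
    have "w ! (i - 1) \<le> w ! (j - 1) \<longleftrightarrow> (i, j) \<in> t" if ij: "i \<in> {1..n}" "j \<in> {1..n}" for i j
      using card_rank_image(2)[OF S, of "h i" "h j"] ij h[OF ij] nth[OF ij(1)] nth[OF ij(2)]
      by (auto simp: c_def S_def)
    then have "le1 (dqp_of_word w) = t"
      using preorder_onD(1)[OF p] len by (auto simp: dqp_of_word_def)
    then have "dqp_of_word w = P"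
      using len by (simp add: P dqp_of_word_def std_dqp_def std_le_def)
    ultimately show "P \<in> dqp_of_word ` packed_words n" by blast
  qed
qed

lemma KE_eq_span: "KE n = hvs.span (tvec n ` tpo n)"
proof -
  have "(\<lambda>w. basis_vec (iso_class (dqp_of_word w)) :: 'a hdqp) ` packed_words n =
      (\<lambda>P. basis_vec (iso_class P)) ` dqp_of_word ` packed_words n"
    by (simp add: image_image)
  then show ?thesis by (simp add: KE_def dqp_of_word_packed image_image)
qed


section \<open>Products and blow ups on total preorders\<close>

definition pullback :: "nat \<Rightarrow> (nat \<Rightarrow> nat) \<Rightarrow> nat rel \<Rightarrow> nat rel" where
  "pullback n f t = {(i, j). i \<in> {1..n} \<and> j \<in> {1..n} \<and> (f i, f j) \<in> t}"

definition perms :: "nat \<Rightarrow> (nat \<Rightarrow> nat) set" where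
  "perms n = {f \<in> extensional {1..n}. bij_betw f {1..n} {1..n}}"

lemma perms_mem: "f \<in> perms n \<Longrightarrow> i \<in> {1..n} \<Longrightarrow> f i \<in> {1..n}"
  by (auto simp: perms_def dest: bij_betwE)

lemma twist_std_dqp: "twist (std_dqp n s) f (std_dqp n t) = std_dqp n (pullback n f t)"
  by (simp add: twist_def pullback_def std_dqp_def)

lemma pullback_tpo:
  assumes f: "f \<in> perms n" and t: "t \<in> tpo n"
  shows "pullback n f t \<in> tpo n"
proof -
  have p: "preorder_on {1..n} t" using t by (simp add: total_preorder_on_def)
  have "total_on {1..n} (pullback n f t)"
    using total_preorder_on_cases[of "{1..n}" t] t perms_mem[OF f]
    by (auto simp: total_on_def pullback_def)
  moreover have "preorder_on {1..n} (pullback n f t)"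
    unfolding preorder_on_def refl_on_def pullback_def
    using preorder_onD(2,3)[OF p] perms_mem[OF f] by (auto intro!: transI)
  ultimately show ?thesis by (simp add: total_preorder_on_def)
qed

lemma std_le_tpo: "std_le n \<in> tpo n"
  by (auto simp: total_preorder_on_def total_on_def std_le_def preorder_on_def refl_on_def intro!: transI)

text \<open>In a total preorder, \<open>i\<close> is strictly below \<open>j\<close> exactly when
  \<open>(j, i)\<close> is absent. This applies to \<open>s\<close> and to the pulled-back order, so
  contraposing the strictness condition yields an inclusion.\<close>

lemma I_lt_std_dqp:
  assumes s: "s \<in> tpo n"
  shows "I_lt (std_dqp n s) (std_dqp n t) = {f \<in> perms n. pullback n f (std_le n) \<subseteq> s}"
proof -
  have st: "strictly s i j \<longleftrightarrow> (j, i) \<notin> s" if "i \<in> {1..n}" "j \<in> {1..n}" for i j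
    using total_preorder_on_cases[of "{1..n}" s i j] s that by (auto simp: strictly_def sim_def)
  have "(\<forall>i\<in>{1..n}. \<forall>j\<in>{1..n}. strictly s i j \<longrightarrow> strictly (std_le n) (f i) (f j)) \<longleftrightarrow>
      pullback n f (std_le n) \<subseteq> s" if f: "f \<in> perms n" for f
  proof -
    have "strictly (std_le n) (f i) (f j) \<longleftrightarrow> (j, i) \<notin> pullback n f (std_le n)"
      if "i \<in> {1..n}" "j \<in> {1..n}" for i j
      using perms_mem[OF f that(1)] perms_mem[OF f that(2)] that
      by (auto simp: pullback_def std_le_def strictly_def sim_def)
    then have "(\<forall>i\<in>{1..n}. \<forall>j\<in>{1..n}. strictly s i j \<longrightarrow> strictly (std_le n) (f i) (f j)) \<longleftrightarrow>
        (\<forall>i\<in>{1..n}. \<forall>j\<in>{1..n}. (j, i) \<in> pullback n f (std_le n) \<longrightarrow> (j, i) \<in> s)"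
      using st by blast
    also have "\<dots> \<longleftrightarrow> pullback n f (std_le n) \<subseteq> s" by (auto simp: pullback_def)
    finally show ?thesis .
  qed
  then have "{f \<in> perms n. \<forall>i\<in>{1..n}. \<forall>j\<in>{1..n}. strictly s i j \<longrightarrow> strictly (std_le n) (f i) (f j)} =
      {f \<in> perms n. pullback n f (std_le n) \<subseteq> s}" by blast
  then show ?thesis by (simp add: I_lt_def perms_def)
qed

text \<open>The additional weak condition is the inclusion opposite to the one in
  \<open>I_lt_std_dqp\<close>.\<close>

lemma I_le_std_dqp:
  assumes s: "s \<in> tpo n"
  shows "I_le (std_dqp n s) (std_dqp n t) = {f \<in> perms n. pullback n f (std_le n) = s}"
proof -
  have "s \<subseteq> {1..n} \<times> {1..n}" using s by (auto simp: total_preorder_on_def preorder_on_def)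
  then have "(\<forall>i\<in>{1..n}. \<forall>j\<in>{1..n}. (i, j) \<in> s \<longrightarrow> (f i, f j) \<in> std_le n) \<longleftrightarrow>
      s \<subseteq> pullback n f (std_le n)" for f
    by (auto simp: pullback_def)
  then show ?thesis unfolding I_le_def I_lt_std_dqp[OF s] by auto
qed

lemma prod_lhd_tvec:
  assumes "s \<in> tpo n" "t \<in> tpo n"
  shows "prod_lhd (tvec n s) (tvec n t) =
    (\<Sum>f | f \<in> perms n \<and> pullback n f (std_le n) \<subseteq> s. tvec n (pullback n f t))"
  using assms by (simp add: prod_lhd_basis[OF dqp_std_dqp dqp_std_dqp] I_lt_std_dqp twist_std_dqp)

lemma prod_unlhd_tvec:
  assumes "s \<in> tpo n" "t \<in> tpo n"
  shows "prod_unlhd (tvec n s) (tvec n t) =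
    (\<Sum>f | f \<in> perms n \<and> pullback n f (std_le n) = s. tvec n (pullback n f t))"
  using assms by (simp add: prod_unlhd_basis[OF dqp_std_dqp dqp_std_dqp] I_le_std_dqp twist_std_dqp)

lemma upsilon_tvec:
  assumes t: "t \<in> tpo n"
  shows "upsilon (tvec n t) = (\<Sum>s | s \<in> tpo n \<and> s \<subseteq> t. tvec n s)"
proof -
  have "blow_ups (std_dqp n t) = std_dqp n ` {s. s \<in> tpo n \<and> s \<subseteq> t}"
    using blow_ups_total_preorder[OF dqp_std_dqp[OF t]] t
    by (simp add: total_preorder_on_def std_dqp_def)
  moreover have "inj_on (std_dqp n) A" for A by (auto simp: inj_on_def std_dqp_def)
  ultimately show ?thesis by (simp add: upsilon_basis[OF dqp_std_dqp[OF t]] sum.reindex)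
qed

text \<open>Pulling back is monotone and keeps total preorders, and pulling back along the inverse
  permutation undoes it.\<close>

lemma bij_betw_pullback:
  assumes f: "f \<in> perms n" and t: "t \<in> tpo n"
  shows "bij_betw (pullback n f) {s. s \<in> tpo n \<and> s \<subseteq> t} {s. s \<in> tpo n \<and> s \<subseteq> pullback n f t}"
proof -
  \<comment> \<open>Members of \<open>perms n\<close> are extensional, hence the restriction of the
    inverse.\<close>
  define k where "k = restrict (inv_into {1..n} f) {1..n}"
  have fb: "bij_betw f {1..n} {1..n}" using f by (simp add: perms_def)
  have "bij_betw k {1..n} {1..n}"
    using bij_betw_inv_into[OF fb]
    by (rule bij_betw_cong[THEN iffD1, rotated]) (simp add: k_def)
  then have k: "k \<in> perms n" by (simp add: perms_def k_def)
  have fk: "\<And>x. x \<in> {1..n} \<Longrightarrow> f (k x) = x" and kf: "\<And>x. x \<in> {1..n} \<Longrightarrow> k (f x) = x"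
    using fb perms_mem[OF f] by (auto simp: k_def bij_betw_inv_into_right bij_betw_inv_into_left)
  have sub: "s \<subseteq> {1..n} \<times> {1..n}" if "s \<in> tpo n" for s
    using that by (auto simp: total_preorder_on_def preorder_on_def)
  have inv: "pullback n k (pullback n f s) = s" "pullback n f (pullback n k s) = s"
    if "s \<in> tpo n" for s
    using sub[OF that] perms_mem[OF f] perms_mem[OF k] fk kf
    by (auto simp: pullback_def)
  have mono: "s \<subseteq> s' \<Longrightarrow> pullback n g s \<subseteq> pullback n g s'" for g s s'
    by (auto simp: pullback_def)
  show ?thesis
  proof (rule bij_betw_byWitness[where f' = "pullback n k"])
    show "pullback n f ` {s. s \<in> tpo n \<and> s \<subseteq> t} \<subseteq> {s. s \<in> tpo n \<and> s \<subseteq> pullback n f t}"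
      using pullback_tpo[OF f] mono[of _ t f] by blast
    show "pullback n k ` {s. s \<in> tpo n \<and> s \<subseteq> pullback n f t} \<subseteq> {s. s \<in> tpo n \<and> s \<subseteq> t}"
      using pullback_tpo[OF k] mono[of _ "pullback n f t" k] inv(1)[OF t] by blast
  qed (use inv in auto)
qed

section \<open>Multiplicativity of \<open>upsilon\<close>\<close>

lemma finite_perms: "finite (perms n)"
proof (rule finite_subset)
  show "perms n \<subseteq> {1..n} \<rightarrow>\<^sub>E {1..n}" by (auto simp: perms_def PiE_def dest: bij_betwE)
  show "finite ({1..n} \<rightarrow>\<^sub>E {1..n})" by (intro finite_PiE) auto
qed

lemma lin_upsilon: "lin upsilon"
  unfolding upsilon_def by (rule lin_linear_ext)

lemma upsilon_prod_tvec:
  assumes s: "s \<in> tpo n" and t: "t \<in> tpo n"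
  shows "upsilon (prod_lhd (tvec n s) (tvec n t)) =
    (prod_unlhd (upsilon (tvec n s)) (upsilon (tvec n t)) :: 'k::field hdqp)"
proof -
  let ?T = "\<lambda>t. {s. s \<in> tpo n \<and> s \<subseteq> t}"
  let ?I = "{f. f \<in> perms n \<and> pullback n f (std_le n) \<subseteq> s}"
  define F :: "(nat \<Rightarrow> nat) \<Rightarrow> 'k hdqp"
    where "F f = (\<Sum>t'\<in>?T t. tvec n (pullback n f t'))" for f
  have "upsilon (prod_lhd (tvec n s) (tvec n t)) =
      (\<Sum>f\<in>?I. \<Sum>u\<in>?T (pullback n f t). tvec n u :: 'k hdqp)"
    unfolding prod_lhd_tvec[OF s t] lin_sum[OF lin_upsilon]
    by (intro sum.cong refl upsilon_tvec pullback_tpo t) auto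
  \<comment> \<open>Refinements of the pulled-back preorder are the pullbacks of refinements of
    \<open>t\<close>, so the inner index set becomes independent of \<open>f\<close>.\<close>
  also have "\<dots> = (\<Sum>f\<in>?I. F f)"
    unfolding F_def by (intro sum.cong refl sum.reindex_bij_betw[symmetric] bij_betw_pullback t) auto
  \<comment> \<open>The permutations are grouped by the order \<open>s'\<close> they pull back.
    Within one group, refining \<open>s\<close> is automatic since \<open>s'\<close> does, so the
    group is the index set in \<open>prod_unlhd_tvec\<close> for \<open>s'\<close>.\<close>
  also have "\<dots> = (\<Sum>s'\<in>?T s. \<Sum>f\<in>{f \<in> ?I. pullback n f (std_le n) = s'}. F f)"
  proof (rule sum.group[symmetric])
    show "finite ?I" using finite_perms by simp
    show "finite (?T s)" using finite_tpo by (rule finite_subset[rotated]) auto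
    show "(\<lambda>f. pullback n f (std_le n)) ` ?I \<subseteq> ?T s" using pullback_tpo[OF _ std_le_tpo] by auto
  qed
  also have "\<dots> = (\<Sum>s'\<in>?T s. \<Sum>t'\<in>?T t. prod_unlhd (tvec n s') (tvec n t'))"
  proof (rule sum.cong[OF refl])
    fix s' assume s': "s' \<in> ?T s"
    then have "{f \<in> ?I. pullback n f (std_le n) = s'} =
        {f. f \<in> perms n \<and> pullback n f (std_le n) = s'}" by auto
    moreover have "(\<Sum>t'\<in>?T t. prod_unlhd (tvec n s') (tvec n t')) =
        (\<Sum>t'\<in>?T t. \<Sum>f | f \<in> perms n \<and> pullback n f (std_le n) = s'. tvec n (pullback n f t') :: 'k hdqp)"
      using s' by (intro sum.cong refl prod_unlhd_tvec) auto
    ultimately show "(\<Sum>f\<in>{f \<in> ?I. pullback n f (std_le n) = s'}. F f) =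
        (\<Sum>t'\<in>?T t. prod_unlhd (tvec n s') (tvec n t'))"
      unfolding F_def by (simp, intro sum.swap)
  qed
  also have "\<dots> = prod_unlhd (upsilon (tvec n s)) (upsilon (tvec n t))"
    unfolding upsilon_tvec[OF s] upsilon_tvec[OF t] prod_unlhd_def
    by (subst sum.swap) (simp only: lin_sum[OF lin_bilinear_ext_left] lin_sum[OF lin_bilinear_ext_right])
  finally show ?thesis .
qed

lemma upsilon_prod_KE:
  assumes x: "x \<in> KE n" and y: "y \<in> KE n"
  shows "upsilon (prod_lhd x y) = prod_unlhd (upsilon x) (upsilon y)"
proof -
  note l = lin_bilinear_ext_left and r = lin_bilinear_ext_right
  have 1: "upsilon (prod_lhd (tvec n s) y) = prod_unlhd (upsilon (tvec n s)) (upsilon y)"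
    if s: "s \<in> tpo n" for s
  proof (rule lin_span_eq[OF _ _ _ y[unfolded KE_eq_span]])
    show "lin (\<lambda>y. upsilon (prod_lhd (tvec n s) y))"
      unfolding prod_lhd_def by (rule lin_compose[OF lin_upsilon r])
    show "lin (\<lambda>y. prod_unlhd (upsilon (tvec n s)) (upsilon y))"
      unfolding prod_unlhd_def by (rule lin_compose[OF r lin_upsilon])
  qed (use upsilon_prod_tvec[OF s] in auto)
  show ?thesis
  proof (rule lin_span_eq[OF _ _ _ x[unfolded KE_eq_span]])
    show "lin (\<lambda>x. upsilon (prod_lhd x y))"
      unfolding prod_lhd_def by (rule lin_compose[OF lin_upsilon l])
    show "lin (\<lambda>x. prod_unlhd (upsilon x) (upsilon y))"
      unfolding prod_unlhd_def by (rule lin_compose[OF l lin_upsilon])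
  qed (use 1 in auto)
qed

section \<open>Bijectivity of \<open>upsilon\<close> on \<open>KE n\<close>\<close>

lemma tvec_in_KE: "t \<in> tpo n \<Longrightarrow> tvec n t \<in> KE n"
  unfolding KE_eq_span by (intro hvs.span_base) auto

lemma subspace_KE: "hvs.subspace (KE n)"
  by (simp add: KE_def)

lemma upsilon_KE: "x \<in> KE n \<Longrightarrow> upsilon x \<in> KE n"
  unfolding KE_eq_span
proof (erule lin_span_subset[OF lin_upsilon hvs.subspace_span, rotated])
  fix b :: "'a hdqp" assume "b \<in> tvec n ` tpo n"
  then obtain t where "t \<in> tpo n" "b = tvec n t" by blast
  then show "upsilon b \<in> hvs.span (tvec n ` tpo n)"
    unfolding KE_eq_span[symmetric] by (auto simp: upsilon_tvec intro!: hvs.subspace_sum[OF subspace_KE] tvec_in_KE)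
qed

text \<open>The image is a subspace, and \<open>tvec n t\<close> is
  \<open>upsilon (tvec n t)\<close> minus the vectors of the strictly finer preorders, which have
  fewer pairs and lie in the image by induction.\<close>

lemma upsilon_surj_KE: "(KE n :: 'k::field hdqp set) \<subseteq> upsilon ` KE n"
proof -
  have sub: "hvs.subspace (upsilon ` KE n :: 'k hdqp set)"
    by (rule subspace_image_lin[OF lin_upsilon subspace_KE])
  have "(tvec n t :: 'k hdqp) \<in> upsilon ` KE n" if "t \<in> tpo n" for t
    using that
  proof (induction "card t" arbitrary: t rule: less_induct)
    case less
    let ?A = "{s. s \<in> tpo n \<and> s \<subset> t}"
    have "finite t"
      by (rule finite_subset[of _ "{1..n} \<times> {1..n}"])
        (use less.prems in \<open>auto simp: total_preorder_on_def preorder_on_def\<close>)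
    then have "(tvec n s :: 'k hdqp) \<in> upsilon ` KE n" if "s \<in> ?A" for s
      using less.hyps[of s] psubset_card_mono[of t s] that by simp
    then have "(\<Sum>s\<in>?A. tvec n s :: 'k hdqp) \<in> upsilon ` KE n"
      by (rule hvs.subspace_sum[OF sub])
    moreover have "upsilon (tvec n t :: 'k hdqp) = tvec n t + (\<Sum>s\<in>?A. tvec n s)"
    proof -
      have "{s. s \<in> tpo n \<and> s \<subseteq> t} = insert t ?A" using less.prems by auto
      moreover have "finite ?A" using finite_tpo by (rule finite_subset[rotated]) auto
      ultimately show ?thesis by (simp add: upsilon_tvec[OF less.prems])
    qed
    moreover have "upsilon (tvec n t :: 'k hdqp) \<in> upsilon ` KE n" using tvec_in_KE[OF less.prems] by blast
    ultimately show ?case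
      using hvs.subspace_diff[OF sub, of "upsilon (tvec n t)" "\<Sum>s\<in>?A. tvec n s"] by simp
  qed
  then have "tvec n ` tpo n \<subseteq> (upsilon ` KE n :: 'k hdqp set)" by blast
  then show ?thesis using hvs.span_minimal[OF _ sub] unfolding KE_eq_span by blast
qed

text \<open>The support condition cuts out a subspace containing the generators. It lets the support
  be indexed by preorders, among which a maximal one can be chosen.\<close>

lemma keys_KE:
  assumes "x \<in> KE n"
  shows "Poly_Mapping.keys x \<subseteq> (\<lambda>t. iso_class (std_dqp n t)) ` tpo n"
proof -
  let ?C = "(\<lambda>t. iso_class (std_dqp n t)) ` tpo n"
  have "hvs.subspace {x :: 'a hdqp. Poly_Mapping.keys x \<subseteq> ?C}"
  proof (rule hvs.subspaceI)
    fix c and x y :: "'a hdqp"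
    assume x: "x \<in> {x. Poly_Mapping.keys x \<subseteq> ?C}"
    have "Poly_Mapping.keys (hscale c x) \<subseteq> Poly_Mapping.keys x" by (auto simp: in_keys_iff)
    with x show "hscale c x \<in> {x. Poly_Mapping.keys x \<subseteq> ?C}" by blast
    assume "y \<in> {x. Poly_Mapping.keys x \<subseteq> ?C}"
    with x show "x + y \<in> {x. Poly_Mapping.keys x \<subseteq> ?C}" using keys_add[of x y] by blast
  qed simp
  moreover have "tvec n ` tpo n \<subseteq> {x :: 'a hdqp. Poly_Mapping.keys x \<subseteq> ?C}"
    by (auto simp: basis_vec_def)
  ultimately show ?thesis using assms unfolding KE_eq_span using hvs.span_minimal by blast
qed

text \<open>The coefficient of \<open>\<Upsilon>(x)\<close> at a total preorder that is maximal in the support of \<open>x\<close>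
  is the coefficient of \<open>x\<close> there.\<close>

lemma upsilon_eq_0_KE:
  assumes x: "x \<in> KE n" and 0: "upsilon x = (0 :: 'k::field hdqp)"
  shows "x = 0"
proof (rule ccontr)
  assume "x \<noteq> 0"
  let ?c = "\<lambda>t. iso_class (std_dqp n t)"
  define A where "A = {t \<in> tpo n. ?c t \<in> Poly_Mapping.keys x}"
  have K: "Poly_Mapping.keys x = ?c ` A" using keys_KE[OF x] by (auto simp: A_def)
  have "finite A" using finite_tpo by (simp add: A_def)
  moreover have "A \<noteq> {}" using K \<open>x \<noteq> 0\<close> by auto
  ultimately obtain t where t: "t \<in> A" and max: "\<And>u. u \<in> A \<Longrightarrow> t \<subseteq> u \<Longrightarrow> u = t"
    using finite_has_maximal[of A] by blast
  have T: "u \<in> tpo n" if "u \<in> A" for u using that by (simp add: A_def)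
  \<comment> \<open>Distinct preorders give distinct classes, so the sum over the support of
    \<open>x\<close> can be reindexed by \<open>A\<close>.\<close>
  have inj: "inj_on ?c A" using T by (auto intro!: inj_onI simp: iso_class_std_dqp_eq_iff)
  have "Poly_Mapping.lookup (upsilon_class (?c u) :: 'k hdqp) (?c t) = (if u = t then 1 else 0)"
    if u: "u \<in> A" for u
  proof -
    let ?S = "{s. s \<in> tpo n \<and> s \<subseteq> u}"
    have fin: "finite ?S" using finite_tpo by (rule finite_subset[rotated]) auto
    have "(upsilon_class (?c u) :: 'k hdqp) = (\<Sum>s\<in>?S. tvec n s)"
      using upsilon_tvec[OF T[OF u], where 'a='k] by (simp add: upsilon_def linear_ext_basis)
    then have "Poly_Mapping.lookup (upsilon_class (?c u) :: 'k hdqp) (?c t) =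
        (\<Sum>s\<in>?S. if s = t then 1 else 0)"
      using T[OF t]
      by (auto simp: lookup_sum basis_vec_def lookup_single when_def iso_class_std_dqp_eq_iff
          intro!: sum.cong)
    \<comment> \<open>A term with \<open>s = t\<close> occurs only if
      \<open>t \<subseteq> u\<close>, and then maximality of \<open>t\<close> gives
      \<open>u = t\<close>.\<close>
    also have "\<dots> = (if u = t then 1 else 0)" using fin max[OF u] T[OF t] by auto
    finally show ?thesis .
  qed
  then have "Poly_Mapping.lookup (upsilon x) (?c t) =
      (\<Sum>u\<in>A. if u = t then Poly_Mapping.lookup x (?c u) else 0)"
    unfolding upsilon_def linear_ext_def K sum.reindex[OF inj] lookup_sum
    by (intro sum.cong) auto
  also have "\<dots> = Poly_Mapping.lookup x (?c t)" using \<open>finite A\<close> t by simp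
  finally show False using 0 t by (simp add: A_def in_keys_iff)
qed

lemma bij_betw_upsilon_KE: "bij_betw upsilon (KE n) (KE n :: 'k::field hdqp set)"
proof -
  have "inj_on upsilon (KE n :: 'k hdqp set)"
  proof (rule inj_onI)
    fix x y :: "'k hdqp" assume "x \<in> KE n" "y \<in> KE n" "upsilon x = upsilon y"
    then show "x = y"
      using upsilon_eq_0_KE[of "x - y" n] lin_diff[OF lin_upsilon, of x y]
        hvs.subspace_diff[OF subspace_KE] by auto
  qed
  then show ?thesis using upsilon_KE upsilon_surj_KE unfolding bij_betw_def by blast
qed

text \<open>Products of generators are sums of \<open>tvec\<close> at pullbacks, which are again
  total preorders; this gives closure.\<close>

lemma algebra_on_KE:
  "algebra_on (KE n) (prod_lhd :: 'k::field hdqp \<Rightarrow> _)"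
  "algebra_on (KE n) (prod_unlhd :: 'k::field hdqp \<Rightarrow> _)"
proof -
  have "prod_lhd b c \<in> KE n" "prod_unlhd b c \<in> KE n"
    if "b \<in> tvec n ` tpo n" "c \<in> tvec n ` tpo n" for b c :: "'k hdqp"
    using that
    by (auto simp: prod_lhd_tvec prod_unlhd_tvec
        intro!: hvs.subspace_sum[OF subspace_KE] tvec_in_KE pullback_tpo[simplified])
  then show "algebra_on (KE n) (prod_lhd :: 'k hdqp \<Rightarrow> _)"
    "algebra_on (KE n) (prod_unlhd :: 'k hdqp \<Rightarrow> _)"
    unfolding prod_lhd_def prod_unlhd_def KE_eq_span
    by (auto intro!: algebra_on_span lhd_class_assoc unlhd_class_assoc)
qed

theorem proposition34:
  fixes n :: nat
  assumes "n \<ge> 1"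
  shows "algebra_isomorphism (KE n :: 'k::field hdqp set) prod_lhd (KE n) prod_unlhd upsilon"
  unfolding algebra_isomorphism_def
  using algebra_on_KE bij_betw_upsilon_KE upsilon_prod_KE
    lin_add[OF lin_upsilon] lin_scale[OF lin_upsilon]
  by blast

end
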